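(* For every positive integer $c$ and every integer $n>2$, there exists an Anosov rational Lie algebra of nilpotency class $c$ and of type $(n,n,\ldots,n)$ ($c$ entries).
   Context: The lower central series is $\gamma_1(\mathfrak{n})=\mathfrak{n}$, $\gamma_i(\mathfrak{n})=[\mathfrak{n},\gamma_{i-1}(\mathfrak{n})]$; $\mathfrak{n}$ has nilpotency class $c$ if $\gamma_{c+1}(\mathfrak{n})=0\neq\gamma_c(\mathfrak{n})$. The type of a nilpotent Lie algebra of class $c$ is the $c$-tuple $(n_1,\ldots,n_c)$ with $n_i=\dim\gamma_i(\mathfrak{n})/\gamma_{i+1}(\mathfrak{n})$. A rational Lie algebra is Anosov if it admits an automorphism that is hyperbolic (no eigenvalue of absolute value $1$) and integer-like (characteristic polynomial with integer coefficients and determinant $\pm1$). *)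

theory Defs
  imports Complex_Main "Jordan_Normal_Form.Char_Poly"
begin

text \<open>A finite-dimensional rational Lie algebra of dimension d is modelled as Q^d,
  realised as functions nat => rat vanishing from index d on, together with
  structure constants C i j k (the k-th coordinate of [e_i, e_j]).\<close>

definition qvecs :: "nat \<Rightarrow> (nat \<Rightarrow> rat) set" where
  "qvecs d = {x. \<forall>i\<ge>d. x i = 0}"

definition lincomb :: "(nat \<Rightarrow> rat) set \<Rightarrow> ((nat \<Rightarrow> rat) \<Rightarrow> rat) \<Rightarrow> (nat \<Rightarrow> rat)" where
  "lincomb F a = (\<lambda>k. \<Sum>v\<in>F. a v * v k)"

definition qspan :: "(nat \<Rightarrow> rat) set \<Rightarrow> (nat \<Rightarrow> rat) set" where
  "qspan S = {lincomb F a | F a. finite F \<and> F \<subseteq> S}"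

definition qindep :: "(nat \<Rightarrow> rat) set \<Rightarrow> bool" where
  "qindep S = (\<forall>F a. finite F \<and> F \<subseteq> S \<and> lincomb F a = (\<lambda>_. 0) \<longrightarrow> (\<forall>v\<in>F. a v = 0))"

definition qbasis :: "(nat \<Rightarrow> rat) set \<Rightarrow> (nat \<Rightarrow> rat) set \<Rightarrow> bool" where
  "qbasis B W = (finite B \<and> B \<subseteq> W \<and> qindep B \<and> qspan B = W)"

definition qdim :: "(nat \<Rightarrow> rat) set \<Rightarrow> nat" where
  "qdim W = card (SOME B. qbasis B W)"

definition bracket :: "nat \<Rightarrow> (nat \<Rightarrow> nat \<Rightarrow> nat \<Rightarrow> rat) \<Rightarrow> (nat \<Rightarrow> rat) \<Rightarrow> (nat \<Rightarrow> rat) \<Rightarrow> (nat \<Rightarrow> rat)" where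
  "bracket d C x y = (\<lambda>k. if k < d then (\<Sum>i<d. \<Sum>j<d. x i * y j * C i j k) else 0)"

definition is_lie_algebra :: "nat \<Rightarrow> (nat \<Rightarrow> nat \<Rightarrow> nat \<Rightarrow> rat) \<Rightarrow> bool" where
  "is_lie_algebra d C \<longleftrightarrow>
     (\<forall>x\<in>qvecs d. bracket d C x x = (\<lambda>_. 0)) \<and>
     (\<forall>x\<in>qvecs d. \<forall>y\<in>qvecs d. \<forall>z\<in>qvecs d.
        (\<lambda>k. bracket d C x (bracket d C y z) k + bracket d C y (bracket d C z x) k
              + bracket d C z (bracket d C x y) k) = (\<lambda>_. 0))"

text \<open>Lower central series, indexed from 1: gamma 1 = n, gamma (i+1) = [n, gamma i].
  (gamma 0 is set to n as a dummy value.)\<close>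
fun lcs :: "nat \<Rightarrow> (nat \<Rightarrow> nat \<Rightarrow> nat \<Rightarrow> rat) \<Rightarrow> nat \<Rightarrow> (nat \<Rightarrow> rat) set" where
  "lcs d C 0 = qvecs d"
| "lcs d C (Suc 0) = qvecs d"
| "lcs d C (Suc (Suc i)) =
     qspan {bracket d C x y | x y. x \<in> qvecs d \<and> y \<in> lcs d C (Suc i)}"

definition nilpotency_class :: "nat \<Rightarrow> (nat \<Rightarrow> nat \<Rightarrow> nat \<Rightarrow> rat) \<Rightarrow> nat \<Rightarrow> bool" where
  "nilpotency_class d C c \<longleftrightarrow>
     lcs d C (c + 1) = {\<lambda>_. 0} \<and> lcs d C c \<noteq> {\<lambda>_. 0}"

text \<open>Type (n_1,...,n_c) with n_i = dim gamma_i / gamma_(i+1) = dim gamma_i - dim gamma_(i+1).\<close>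
definition has_type :: "nat \<Rightarrow> (nat \<Rightarrow> nat \<Rightarrow> nat \<Rightarrow> rat) \<Rightarrow> nat \<Rightarrow> nat list \<Rightarrow> bool" where
  "has_type d C c ns \<longleftrightarrow> length ns = c \<and>
     (\<forall>i\<in>{1..c}. qdim (lcs d C i) - qdim (lcs d C (i + 1)) = ns ! (i - 1))"

definition mat_act :: "nat \<Rightarrow> rat mat \<Rightarrow> (nat \<Rightarrow> rat) \<Rightarrow> (nat \<Rightarrow> rat)" where
  "mat_act d A x = (\<lambda>i. if i < d then (\<Sum>j<d. A $$ (i, j) * x j) else 0)"

definition is_automorphism :: "nat \<Rightarrow> (nat \<Rightarrow> nat \<Rightarrow> nat \<Rightarrow> rat) \<Rightarrow> rat mat \<Rightarrow> bool" where
  "is_automorphism d C A \<longleftrightarrow> A \<in> carrier_mat d d \<and>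
     bij_betw (mat_act d A) (qvecs d) (qvecs d) \<and>
     (\<forall>x\<in>qvecs d. \<forall>y\<in>qvecs d.
        mat_act d A (bracket d C x y) = bracket d C (mat_act d A x) (mat_act d A y))"

definition hyperbolic :: "rat mat \<Rightarrow> bool" where
  "hyperbolic A \<longleftrightarrow>
     (\<forall>z::complex. poly (map_poly of_rat (char_poly A)) z = 0 \<longrightarrow> cmod z \<noteq> 1)"

definition integer_like :: "rat mat \<Rightarrow> bool" where
  "integer_like A \<longleftrightarrow> (\<forall>i. coeff (char_poly A) i \<in> \<int>) \<and> (det A = 1 \<or> det A = -1)"

definition anosov :: "nat \<Rightarrow> (nat \<Rightarrow> nat \<Rightarrow> nat \<Rightarrow> rat) \<Rightarrow> bool" where
  "anosov d C \<longleftrightarrow> (\<exists>A. is_automorphism d C A \<and> hyperbolic A \<and> integer_like A)"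

end

theory Submission
  imports Defs "HOL-Library.Function_Algebras"
begin

text \<open>
  Let \<open>K\<close> be a totally real etale \<open>\<rat>\<close>-algebra of degree \<open>n\<close> with an automorphism \<open>\<sigma>\<close> that permutes the
  \<open>n\<close> embeddings in cycles of length at least 3. On \<open>K\<^sup>c\<close>, graded in levels \<open>0, \<dots>, c - 1\<close>, put
  \<open>[a, b] = a \<sigma>(b) - \<sigma>(a) b\<close> from level 0 and level 0 to level 1, and \<open>[a, y] = a y\<close> from level 0 and
  level \<open>k \<ge> 1\<close> to level \<open>k + 1\<close>; all other brackets vanish. After extending scalars to the reals,
  level 0 has a basis \<open>X\<^sub>i\<close> indexed by the embeddings and level \<open>k\<close> is spanned by
  \<open>ad(X\<^sub>i)\<^sup>k X\<^sub>j\<close>, where \<open>j\<close> follows \<open>i\<close> in its cycle. The elements \<open>a \<sigma>(b) - \<sigma>(a) b\<close> span \<open>K\<close>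
  because the cycles have length at least 3, so the type is \<open>(n, \<dots>, n)\<close>. A unit \<open>u\<close> of an order of \<open>K\<close>
  acts by multiplication by \<open>u\<close> on level 0 and by \<open>u\<^sup>k \<sigma>(u)\<close> on level \<open>k\<close>; this is an integer-like
  automorphism, and it is hyperbolic if no conjugate of these units has absolute value 1.

  Such triples \<open>(K, \<sigma>, u)\<close> are closed under direct sums, hence degrees 3, 4 and 5 suffice. There \<open>K\<close> is
  generated by \<open>u = 2 cos (2 \<pi> / N)\<close> with \<open>N = 7, 15, 11\<close> and \<open>\<sigma>(u) = u\<^sup>2 - 2\<close> doubles the angle.
\<close>

section \<open>Rational coordinate spaces\<close>

lemma sum_fun_apply: "(\<Sum>v\<in>F. f v) k = (\<Sum>v\<in>F. f v k)"
  for f :: "'a \<Rightarrow> 'b \<Rightarrow> 'c::comm_monoid_add"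
  by (induction F rule: infinite_finite_induct) auto

text \<open>With the pointwise addition of \<open>Function_Algebras\<close> these functions form a
  rational vector space, so \<open>qspan\<close>, \<open>qindep\<close> and \<open>qdim\<close> can
  be traded for the library notions of span, dependence and dimension.\<close>

interpretation qfun: vector_space "\<lambda>(a::rat) (v::nat \<Rightarrow> rat) k. a * v k"
  by unfold_locales (auto simp: algebra_simps)

lemma lincomb_eq_sum: "lincomb F a = (\<Sum>v\<in>F. (\<lambda>k. a v * v k))"
  by (rule ext) (simp add: lincomb_def sum_fun_apply)

lemma qspan_eq_span: "qspan S = qfun.span S"
  unfolding qspan_def qfun.span_explicit lincomb_eq_sum by simp

lemma qindep_iff_independent: "qindep S \<longleftrightarrow> \<not> qfun.dependent S"
  unfolding qindep_def qfun.dependent_explicit lincomb_eq_sum zero_fun_def by blast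

text \<open>\<open>qdim\<close> counts a basis chosen by \<open>SOME\<close>; all bases have
  \<open>qfun.dim W\<close> elements, so any explicit basis may be counted instead.\<close>

lemma qdim_eq_card:
  assumes "qbasis B W"
  shows "qdim W = card B"
proof -
  have "card B' = qfun.dim W" if "qbasis B' W" for B'
    using that qfun.basis_card_eq_dim[of B' W]
    unfolding qbasis_def qspan_eq_span qindep_iff_independent by auto
  with assms show ?thesis
    unfolding qdim_def by (metis (mono_tags, lifting) someI_ex)
qed

definition unit_fun :: "nat \<Rightarrow> nat \<Rightarrow> rat" where
  "unit_fun p = (\<lambda>q. if q = p then 1 else 0)"

text \<open>The terms of the lower central series turn out to be these coordinate subspaces, with
  \<open>k\<close> a multiple of the type entry \<open>n\<close>.\<close>

definition tail_vecs :: "nat \<Rightarrow> nat \<Rightarrow> (nat \<Rightarrow> rat) set" where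
  "tail_vecs k d = {x \<in> qvecs d. \<forall>p<k. x p = 0}"

lemma tail_vecs_eq_sum:
  assumes "x \<in> tail_vecs k d"
  shows "x = (\<Sum>p\<in>{k..<d}. (\<lambda>q. x p * unit_fun p q))"
proof
  fix q
  have "x q = (if q \<in> {k..<d} then x q else 0)"
    using assms by (auto simp: tail_vecs_def qvecs_def)
  then show "x q = (\<Sum>p\<in>{k..<d}. (\<lambda>q. x p * unit_fun p q)) q"
    by (simp add: sum_fun_apply unit_fun_def if_distrib cong: if_cong)
qed

lemma subspace_tail_vecs: "qfun.subspace (tail_vecs k d)"
  by (auto simp: qfun.subspace_def tail_vecs_def qvecs_def)

lemma tail_vecs_subset_span:
  assumes "\<And>p. k \<le> p \<Longrightarrow> p < d \<Longrightarrow> unit_fun p \<in> qfun.span S"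
  shows "tail_vecs k d \<subseteq> qfun.span S"
proof
  fix x assume "x \<in> tail_vecs k d"
  then show "x \<in> qfun.span S"
    by (subst tail_vecs_eq_sum) (auto intro!: qfun.span_sum qfun.span_scale assms)
qed

lemma inj_unit_fun: "inj unit_fun"
  by (rule injI) (metis unit_fun_def zero_neq_one)

lemma qbasis_tail_vecs: "qbasis (unit_fun ` {k..<d}) (tail_vecs k d)"
proof -
  let ?B = "unit_fun ` {k..<d}"
  have sub: "?B \<subseteq> tail_vecs k d"
    by (auto simp: tail_vecs_def qvecs_def unit_fun_def)
  have "qindep ?B"
    unfolding qindep_def
  proof (intro allI impI ballI)
    fix F a v assume F: "finite F \<and> F \<subseteq> ?B \<and> lincomb F a = (\<lambda>_. 0)" and v: "v \<in> F"
    then obtain p where p: "v = unit_fun p" by auto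
    \<comment> \<open>Coordinate \<open>p\<close> of the relation isolates the coefficient of
      \<open>unit_fun p\<close>.\<close>
    have "(\<Sum>w\<in>F. a w * w p) = (\<Sum>w\<in>F. if w = v then a v else 0)"
    proof (rule sum.cong[OF refl])
      fix w assume "w \<in> F"
      then obtain q where "w = unit_fun q" using F by auto
      moreover from this have "w p = (if w = v then 1 else 0)"
        using p by (cases "q = p") (auto simp: unit_fun_def fun_eq_iff)
      ultimately show "a w * w p = (if w = v then a v else 0)" by simp
    qed
    then have "(\<Sum>w\<in>F. a w * w p) = a v" using F v by simp
    moreover have "(\<Sum>w\<in>F. a w * w p) = 0" using F by (metis lincomb_def)
    ultimately show "a v = 0" by simp
  qed
  moreover have "qspan ?B = tail_vecs k d"
    unfolding qspan_eq_span
  proof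
    show "qfun.span ?B \<subseteq> tail_vecs k d"
      by (rule qfun.span_minimal[OF sub subspace_tail_vecs])
    show "tail_vecs k d \<subseteq> qfun.span ?B"
      by (rule tail_vecs_subset_span) (auto intro: qfun.span_base)
  qed
  ultimately show ?thesis using sub by (simp add: qbasis_def)
qed

lemma qdim_tail_vecs: "qdim (tail_vecs k d) = d - k"
proof -
  have "inj_on unit_fun {k..<d}" using inj_unit_fun by (rule inj_on_subset) simp
  then show ?thesis by (simp add: qdim_eq_card[OF qbasis_tail_vecs] card_image)
qed

lemma bracket_in_qvecs: "bracket d C x y \<in> qvecs d"
  by (simp add: bracket_def qvecs_def)

lemma unit_fun_in_tail: "k \<le> p \<Longrightarrow> p < d \<Longrightarrow> unit_fun p \<in> tail_vecs k d"
  by (auto simp: tail_vecs_def qvecs_def unit_fun_def)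

section \<open>Lattices in a power of the reals\<close>

text \<open>Column \<open>j\<close> of \<open>E\<close> is a basis vector and row \<open>i\<close>
  an embedding; only the entries of \<open>v\<close> below \<open>n\<close> count, hence the
  transfer rule \<open>in_lattice_cong\<close>.\<close>

definition in_lattice :: "nat \<Rightarrow> (nat \<Rightarrow> nat \<Rightarrow> real) \<Rightarrow> (nat \<Rightarrow> real) \<Rightarrow> bool" where
  "in_lattice n E v \<longleftrightarrow> (\<exists>z::nat \<Rightarrow> int. \<forall>i<n. v i = (\<Sum>j<n. of_int (z j) * E i j))"

definition lattice_coord :: "nat \<Rightarrow> (nat \<Rightarrow> nat \<Rightarrow> real) \<Rightarrow> (nat \<Rightarrow> real) \<Rightarrow> nat \<Rightarrow> int" where
  "lattice_coord n E v = (SOME z. \<forall>i<n. v i = (\<Sum>j<n. of_int (z j) * E i j))"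

lemma lattice_coord:
  assumes "in_lattice n E v" "i < n"
  shows "(\<Sum>j<n. of_int (lattice_coord n E v j) * E i j) = v i"
proof -
  have "\<forall>i<n. v i = (\<Sum>j<n. of_int (lattice_coord n E v j) * E i j)"
    using someI_ex[OF assms(1)[unfolded in_lattice_def]] unfolding lattice_coord_def .
  with assms(2) show ?thesis by simp
qed

lemma in_lattice_zero: "in_lattice n E (\<lambda>_. 0)"
  unfolding in_lattice_def by (intro exI[of _ "\<lambda>_. 0"]) simp

lemma in_lattice_add:
  assumes "in_lattice n E v" "in_lattice n E w"
  shows "in_lattice n E (\<lambda>i. v i + w i)"
proof -
  from assms obtain z z' where
    "\<forall>i<n. v i = (\<Sum>j<n. of_int (z j) * E i j)" "\<forall>i<n. w i = (\<Sum>j<n. of_int (z' j) * E i j)"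
    by (auto simp: in_lattice_def)
  then show ?thesis
    unfolding in_lattice_def
    by (intro exI[of _ "\<lambda>j. z j + z' j"]) (simp add: algebra_simps sum.distrib)
qed

lemma in_lattice_scale:
  assumes "in_lattice n E v"
  shows "in_lattice n E (\<lambda>i. of_int a * v i)"
proof -
  from assms obtain z where "\<forall>i<n. v i = (\<Sum>j<n. of_int (z j) * E i j)"
    by (auto simp: in_lattice_def)
  then show ?thesis
    unfolding in_lattice_def
    by (intro exI[of _ "\<lambda>j. a * z j"]) (simp add: sum_distrib_left algebra_simps)
qed

lemma in_lattice_sum:
  assumes "\<And>a. a \<in> A \<Longrightarrow> in_lattice n E (v a)"
  shows "in_lattice n E (\<lambda>i. \<Sum>a\<in>A. v a i)"
  using assms
  by (induction A rule: infinite_finite_induct) (auto intro: in_lattice_zero in_lattice_add)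

lemma in_lattice_cong:
  assumes "in_lattice n E v" "\<And>i. i < n \<Longrightarrow> v i = w i"
  shows "in_lattice n E w"
  using assms by (auto simp: in_lattice_def)

lemma in_lattice_basis:
  assumes "j < n"
  shows "in_lattice n E (\<lambda>i. E i j)"
  unfolding in_lattice_def
  using assms by (intro exI[of _ "\<lambda>k. if k = j then 1 else 0"]) (simp add: if_distrib if_distribR cong: if_cong)

text \<open>Multiplication by \<open>h\<close> is additive, so stability of the lattice only has to
  be tested on the basis.\<close>

lemma in_lattice_mult:
  assumes "\<And>j. j < n \<Longrightarrow> in_lattice n E (\<lambda>i. h i * E i j)" "in_lattice n E v"
  shows "in_lattice n E (\<lambda>i. h i * v i)"
proof -
  from assms(2) obtain z where z: "\<forall>i<n. v i = (\<Sum>j<n. of_int (z j) * E i j)"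
    by (auto simp: in_lattice_def)
  have "in_lattice n E (\<lambda>i. \<Sum>j<n. of_int (z j) * (h i * E i j))"
    by (intro in_lattice_sum in_lattice_scale assms(1)) simp
  then show ?thesis
    by (rule in_lattice_cong) (simp add: z sum_distrib_left algebra_simps)
qed

section \<open>Sums and products over coordinates arranged in blocks\<close>

lemma sum_lessThan_add:
  fixes f :: "nat \<Rightarrow> 'a::comm_monoid_add"
  shows "(\<Sum>j<m + n. f j) = (\<Sum>j<m. f j) + (\<Sum>j<n. f (m + j))"
  by (induction n) (simp_all add: add.assoc)

lemma prod_lessThan_add:
  fixes f :: "nat \<Rightarrow> 'a::comm_monoid_mult"
  shows "(\<Prod>j<m + n. f j) = (\<Prod>j<m. f j) * (\<Prod>j<n. f (m + j))"
  by (induction n) (simp_all add: mult.assoc)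

lemma sum_lessThan_mult:
  fixes f :: "nat \<Rightarrow> 'a::comm_monoid_add"
  shows "(\<Sum>p<c * n. f p) = (\<Sum>k<c. \<Sum>j<n. f (k * n + j))"
  by (induction c) (simp_all add: sum_lessThan_add add.commute[of n])

lemma prod_lessThan_mult:
  fixes f :: "nat \<Rightarrow> 'a::comm_monoid_mult"
  shows "(\<Prod>p<c * n. f p) = (\<Prod>k<c. \<Prod>j<n. f (k * n + j))"
  by (induction c) (simp_all add: prod_lessThan_add add.commute[of n])

lemma block_index_less: "k < c \<Longrightarrow> j < n \<Longrightarrow> k * n + j < c * (n::nat)"
  by (metis add_less_cancel_left less_le_trans mult_le_mono1 mult_Suc add.commute Suc_leI)

text \<open>Each part of the bracket pairs one level of the first factor with one level of the
  second, so the sum over all pairs of levels collapses to a single pair of blocks.\<close>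

lemma sum_blocks_only:
  fixes g :: "nat \<Rightarrow> nat \<Rightarrow> nat \<Rightarrow> nat \<Rightarrow> 'a::comm_monoid_add"
  assumes "k0 < c" "k1 < c" "\<And>k a k' b. k \<noteq> k0 \<or> k' \<noteq> k1 \<Longrightarrow> g k a k' b = 0"
  shows "(\<Sum>k<c. \<Sum>a<n. \<Sum>k'<c. \<Sum>b<n. g k a k' b) = (\<Sum>a<n. \<Sum>b<n. g k0 a k1 b)"
proof -
  have "(\<Sum>k<c. \<Sum>a<n. \<Sum>k'<c. \<Sum>b<n. g k a k' b) = (\<Sum>a<n. \<Sum>k'<c. \<Sum>b<n. g k0 a k' b)"
    using assms by (subst sum.remove[of _ k0]) (auto intro!: sum.neutral)
  also have "\<dots> = (\<Sum>a<n. \<Sum>b<n. g k0 a k1 b)"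
  proof (rule sum.cong[OF refl])
    fix a
    show "(\<Sum>k'<c. \<Sum>b<n. g k0 a k' b) = (\<Sum>b<n. g k0 a k1 b)"
      using assms by (subst sum.remove[of _ k1]) (auto intro!: sum.neutral)
  qed
  finally show ?thesis .
qed

lemma sum_block_only:
  fixes g :: "nat \<Rightarrow> nat \<Rightarrow> 'a::comm_monoid_add"
  assumes "k < c"
  shows "(\<Sum>k'<c. \<Sum>j<n. if k = k' then g k' j else 0) = (\<Sum>j<n. g k j)"
  using assms by (subst sum.remove[of _ k]) (auto intro!: sum.neutral)

lemma block_obtain:
  fixes p c n :: nat
  assumes "p < c * n"
  obtains k j where "p = k * n + j" "k < c" "j < n"
proof
  show "p = (p div n) * n + p mod n" by simp
  show "p div n < c" using assms by (rule less_mult_imp_div_less)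
  show "p mod n < n" using assms by (cases n) auto
qed

text \<open>The split follows the shape of the bracket: level 0 receives nothing, level 1 the skew
  product, later levels the plain product.\<close>

lemma level_cases:
  obtains "k = 0" | "k = 1" | l where "k = Suc l" "l \<noteq> 0"
  by (metis One_nat_def not0_implies_Suc)

section \<open>Invertible matrices acting on rational vectors\<close>

lemma mat_inverse_exists:
  fixes A :: "'a::field mat"
  assumes A: "A \<in> carrier_mat d d" and "det A \<noteq> 0"
  obtains B where "B \<in> carrier_mat d d" "A * B = 1\<^sub>m d" "B * A = 1\<^sub>m d"
  \<comment> \<open>The argument \<open>undefined\<close> fills the extension slot of the record
    \<open>ring_mat\<close>, on which \<open>Units\<close> does not depend.\<close>
  using det_non_zero_imp_unit[OF A assms(2), of undefined]
  by (auto simp: Units_def ring_mat_def)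

lemma mat_act_mat_act_inverse:
  assumes "A \<in> carrier_mat d d" "B \<in> carrier_mat d d" "A * B = 1\<^sub>m d" "x \<in> qvecs d"
  shows "mat_act d A (mat_act d B x) = x"
proof
  fix i
  show "mat_act d A (mat_act d B x) i = x i"
  proof (cases "i < d")
    case True
    have "mat_act d A (mat_act d B x) i = (\<Sum>j<d. \<Sum>k<d. A $$ (i, j) * B $$ (j, k) * x k)"
      using True by (simp add: mat_act_def sum_distrib_left mult.assoc)
    also have "\<dots> = (\<Sum>k<d. \<Sum>j<d. A $$ (i, j) * B $$ (j, k) * x k)"
      by (rule sum.swap)
    also have "\<dots> = (\<Sum>k<d. (A * B) $$ (i, k) * x k)"
      using True assms(1,2)
      by (intro sum.cong refl) (simp add: scalar_prod_def sum_distrib_right lessThan_atLeast0)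
    also have "\<dots> = x i"
      using True by (simp add: assms(3) if_distrib if_distribR cong: sum.cong_simp if_cong)
    finally show ?thesis .
  qed (use assms in \<open>simp add: mat_act_def qvecs_def\<close>)
qed

lemma mat_act_in_qvecs: "mat_act d A x \<in> qvecs d"
  by (simp add: mat_act_def qvecs_def)

lemma bij_betw_mat_act:
  assumes "A \<in> carrier_mat d d" "det A \<noteq> 0"
  shows "bij_betw (mat_act d A) (qvecs d) (qvecs d)"
proof -
  obtain B where "B \<in> carrier_mat d d" "A * B = 1\<^sub>m d" "B * A = 1\<^sub>m d"
    using mat_inverse_exists[OF assms] .
  with assms show ?thesis
    by (intro bij_betw_byWitness[where f' = "mat_act d B"])
      (auto simp: mat_act_mat_act_inverse mat_act_in_qvecs)
qed

section \<open>The Lie algebra of a lattice with a unit\<close>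

text \<open>The order is embedded in the reals to the power \<open>n\<close> by its \<open>n\<close> real embeddings: \<open>E i j\<close> is the \<open>i\<close>-th
  conjugate of the \<open>j\<close>-th basis element, \<open>u i\<close> the \<open>i\<close>-th conjugate of the unit, and the automorphism is
  the permutation \<open>s\<close> of the embeddings.\<close>

locale unit_lattice =
  fixes n :: nat and E :: "nat \<Rightarrow> nat \<Rightarrow> real" and s :: "nat \<Rightarrow> nat" and u :: "nat \<Rightarrow> real"
  assumes bij_s: "bij_betw s {..<n} {..<n}"
    and E_inj: "\<And>z. \<forall>i<n. (\<Sum>j<n. z j * E i j) = 0 \<Longrightarrow> \<forall>j<n. z j = 0"
    and one: "in_lattice n E (\<lambda>_. 1)"
    and mult: "\<And>j k. j < n \<Longrightarrow> k < n \<Longrightarrow> in_lattice n E (\<lambda>i. E i j * E i k)"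
    and skew: "\<And>j k. j < n \<Longrightarrow> k < n \<Longrightarrow>
      in_lattice n E (\<lambda>i. E i j * E (s i) k - E (s i) j * E i k)"
    and unit: "\<And>j. j < n \<Longrightarrow> in_lattice n E (\<lambda>i. u i * E i j)"
    and unit_s: "\<And>j. j < n \<Longrightarrow> in_lattice n E (\<lambda>i. u (s i) * E i j)"
    and skew_span: "\<And>k. k < n \<Longrightarrow> \<exists>r. \<forall>i<n. E i k =
      (\<Sum>a<n. \<Sum>b<n. of_rat (r a b) * (E i a * E (s i) b - E (s i) a * E i b))"
    and norm_u: "\<bar>\<Prod>i<n. u i\<bar> = 1"
    and u_abs: "\<And>i. i < n \<Longrightarrow> \<bar>u i\<bar> \<noteq> 1"
    and u_pow_abs: "\<And>i k. i < n \<Longrightarrow> 1 \<le> k \<Longrightarrow> \<bar>u i ^ k * u (s i)\<bar> \<noteq> 1"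
begin

definition mult_const :: "nat \<Rightarrow> nat \<Rightarrow> nat \<Rightarrow> int" where
  "mult_const a b = lattice_coord n E (\<lambda>i. E i a * E i b)"

definition skew_const :: "nat \<Rightarrow> nat \<Rightarrow> nat \<Rightarrow> int" where
  "skew_const a b = lattice_coord n E (\<lambda>i. E i a * E (s i) b - E (s i) a * E i b)"

text \<open>The coordinate \<open>k * n + j\<close> belongs to level \<open>k\<close> and to the \<open>j\<close>-th basis element.\<close>

definition lie_const :: "nat \<Rightarrow> nat \<Rightarrow> nat \<Rightarrow> rat" where
  "lie_const p q r =
     (if p div n = 0 \<and> q div n = 0 \<and> r div n = 1
      then of_int (skew_const (p mod n) (q mod n) (r mod n)) else 0)
   + (if p div n = 0 \<and> q div n \<noteq> 0 \<and> r div n = Suc (q div n)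
      then of_int (mult_const (p mod n) (q mod n) (r mod n)) else 0)
   - (if q div n = 0 \<and> p div n \<noteq> 0 \<and> r div n = Suc (p div n)
      then of_int (mult_const (q mod n) (p mod n) (r mod n)) else 0)"

text \<open>The \<open>i\<close>-th real embedding of the level \<open>k\<close> component. In these
  coordinates products in the order are pointwise, so the Lie algebra and its automorphism are given
  by formulas in real numbers.\<close>

definition emb :: "nat \<Rightarrow> (nat \<Rightarrow> rat) \<Rightarrow> nat \<Rightarrow> real" where
  "emb k x i = (\<Sum>j<n. of_rat (x (k * n + j)) * E i j)"

text \<open>Compatibility with the bracket forces these factors: the skew product of level 0 with
  itself scales by \<open>u i * u (s i)\<close>, and every further bracket with level 0 contributes
  one more \<open>u i\<close>.\<close>

definition weight :: "nat \<Rightarrow> nat \<Rightarrow> real" where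
  "weight k i = (if k = 0 then u i else u i ^ k * u (s i))"

text \<open>Block \<open>k\<close> is the matrix of multiplication by \<open>weight k\<close> in the
  lattice basis. It is kept over the integers because this makes its characteristic polynomial
  integral.\<close>

definition unit_mat :: "nat \<Rightarrow> int mat" where
  "unit_mat d = mat d d (\<lambda>(p, q). if p div n = q div n
     then lattice_coord n E (\<lambda>i. weight (p div n) i * E i (q mod n)) (p mod n) else 0)"

text \<open>If \<open>w\<close> lists the lattice coordinates of the values \<open>h a b\<close> of
  a bilinear map on basis elements, applying the embedding to the coordinate formula gives back
  \<open>h\<close>.\<close>

lemma emb_bilinear:
  assumes w: "\<And>a b. a < n \<Longrightarrow> b < n \<Longrightarrow> (\<Sum>j<n. of_int (w a b j) * E i j) = h a b"
    and z: "\<And>j. j < n \<Longrightarrow> z (k * n + j) = (\<Sum>a<n. \<Sum>b<n. x a * y b * of_int (w a b j))"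
  shows "emb k z i = (\<Sum>a<n. \<Sum>b<n. of_rat (x a) * of_rat (y b) * h a b)"
proof -
  have "emb k z i = (\<Sum>j<n. \<Sum>a<n. \<Sum>b<n. of_rat (x a) * of_rat (y b) * (of_int (w a b j) * E i j))"
    unfolding emb_def
    by (intro sum.cong refl) (simp add: z of_rat_sum of_rat_mult sum_distrib_right mult.assoc)
  also have "\<dots> = (\<Sum>a<n. \<Sum>j<n. \<Sum>b<n. of_rat (x a) * of_rat (y b) * (of_int (w a b j) * E i j))"
    by (rule sum.swap)
  also have "\<dots> = (\<Sum>a<n. \<Sum>b<n. \<Sum>j<n. of_rat (x a) * of_rat (y b) * (of_int (w a b j) * E i j))"
    by (intro sum.cong refl sum.swap)
  also have "\<dots> = (\<Sum>a<n. \<Sum>b<n. of_rat (x a) * of_rat (y b) * h a b)"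
    by (intro sum.cong refl) (simp add: w flip: sum_distrib_left)
  finally show ?thesis .
qed

section \<open>The bracket under the real embeddings\<close>

lemma bracket_block:
  assumes "l < c" "j < n"
  shows "bracket (c * n) lie_const x y (l * n + j) =
    (\<Sum>k<c. \<Sum>a<n. \<Sum>k'<c. \<Sum>b<n. x (k * n + a) * y (k' * n + b) *
      ((if k = 0 \<and> k' = 0 \<and> l = 1 then of_int (skew_const a b j) else 0)
     + (if k = 0 \<and> k' \<noteq> 0 \<and> l = Suc k' then of_int (mult_const a b j) else 0)
     - (if k' = 0 \<and> k \<noteq> 0 \<and> l = Suc k then of_int (mult_const b a j) else 0)))"
proof -
  have div_mod: "(k * n + a) div n = k" "(k * n + a) mod n = a" if "a < n" for k a
    using that by simp_all
  show ?thesis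
    using assms block_index_less[of l c j n]
    by (simp add: bracket_def sum_lessThan_mult lie_const_def div_mod del: mult_Suc cong: sum.cong_simp if_cong)
qed

lemma emb_bracket_0:
  assumes "0 < c" "i < n"
  shows "emb 0 (bracket (c * n) lie_const x y) i = 0"
proof -
  have "bracket (c * n) lie_const x y (0 * n + j) = 0" if "j < n" for j
    by (subst bracket_block) (use assms that in \<open>auto intro!: sum.neutral\<close>)
  then show ?thesis by (simp add: emb_def)
qed

lemma emb_bracket_1:
  assumes "1 < c" "i < n" "s i < n"
  shows "emb 1 (bracket (c * n) lie_const x y) i = emb 0 x i * emb 0 y (s i) - emb 0 x (s i) * emb 0 y i"
proof -
  have "bracket (c * n) lie_const x y (1 * n + j)
      = (\<Sum>a<n. \<Sum>b<n. x a * y b * of_int (skew_const a b j))" if "j < n" for j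
    unfolding bracket_block[OF assms(1) that]
    by (subst sum_blocks_only[of 0 c 0]) (use assms in auto)
  then have "emb 1 (bracket (c * n) lie_const x y) i
     = (\<Sum>a<n. \<Sum>b<n. of_rat (x a) * of_rat (y b) * (E i a * E (s i) b - E (s i) a * E i b))"
    by (intro emb_bilinear[where w = skew_const]) (auto simp: skew_const_def lattice_coord skew assms)
  also have "\<dots> = emb 0 x i * emb 0 y (s i) - emb 0 x (s i) * emb 0 y i"
    unfolding emb_def sum_product sum_subtractf[symmetric]
    by (intro sum.cong refl) (simp add: algebra_simps)
  finally show ?thesis .
qed

lemma emb_bracket_Suc:
  assumes "Suc l < c" "l \<noteq> 0" "i < n"
  shows "emb (Suc l) (bracket (c * n) lie_const x y) i = emb 0 x i * emb l y i - emb 0 y i * emb l x i"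
proof -
  \<comment> \<open>\<open>f x y\<close> multiplies level 0 of \<open>x\<close> with level
    \<open>l\<close> of \<open>y\<close>; the bracket in level \<open>Suc l\<close> is its
    antisymmetrization.\<close>
  define f where "f x y j = (\<Sum>a<n. \<Sum>b<n. x a * y (l * n + b) * of_int (mult_const a b j))"
    for x y :: "nat \<Rightarrow> rat" and j
  have *: "emb (Suc l) z i = emb 0 x i * emb l y i" if "\<And>j. j < n \<Longrightarrow> z (Suc l * n + j) = f x y j" for x y z
  proof -
    have "emb (Suc l) z i = (\<Sum>a<n. \<Sum>b<n. of_rat (x a) * of_rat (y (l * n + b)) * (E i a * E i b))"
      by (intro emb_bilinear[where w = mult_const])
        (auto simp: mult_const_def lattice_coord mult assms f_def that simp del: mult_Suc)
    also have "\<dots> = emb 0 x i * emb l y i"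
      by (simp add: emb_def sum_product algebra_simps)
    finally show ?thesis .
  qed
  have br: "bracket (c * n) lie_const x y (Suc l * n + j) = f x y j - f y x j" if "j < n" for j
  proof -
    let ?g = "\<lambda>k a k' b. x (k * n + a) * y (k' * n + b) *
        (if k = 0 \<and> k' = l then of_int (mult_const a b j) else 0)"
    let ?h = "\<lambda>k a k' b. x (k * n + a) * y (k' * n + b) *
        (if k' = 0 \<and> k = l then of_int (mult_const b a j) else 0)"
    have "bracket (c * n) lie_const x y (Suc l * n + j)
      = (\<Sum>k<c. \<Sum>a<n. \<Sum>k'<c. \<Sum>b<n. ?g k a k' b - ?h k a k' b)"
      unfolding bracket_block[OF assms(1) that]
      by (intro sum.cong refl) (use assms in auto)
    also have "\<dots> = (\<Sum>k<c. \<Sum>a<n. \<Sum>k'<c. \<Sum>b<n. ?g k a k' b)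
        - (\<Sum>k<c. \<Sum>a<n. \<Sum>k'<c. \<Sum>b<n. ?h k a k' b)"
      by (simp only: sum_subtractf)
    also have "(\<Sum>k<c. \<Sum>a<n. \<Sum>k'<c. \<Sum>b<n. ?g k a k' b) = f x y j"
      by (subst sum_blocks_only[of 0 c l]) (use assms in \<open>auto simp: f_def\<close>)
    also have "(\<Sum>k<c. \<Sum>a<n. \<Sum>k'<c. \<Sum>b<n. ?h k a k' b)
        = (\<Sum>a<n. \<Sum>b<n. x (l * n + a) * y b * of_int (mult_const b a j))"
      by (subst sum_blocks_only[of l c 0]) (use assms in auto)
    also have "\<dots> = f y x j"
      unfolding f_def by (subst sum.swap) (simp add: mult.commute)
    finally show ?thesis .
  qed
  \<comment> \<open>The shift by \<open>Suc l * n\<close> places the coordinates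
    \<open>f x y\<close> in block \<open>Suc l\<close>, so that \<open>*\<close> applies to each of
    the two terms.\<close>
  have "emb (Suc l) (bracket (c * n) lie_const x y) i
      = emb (Suc l) (\<lambda>p. f x y (p - Suc l * n)) i - emb (Suc l) (\<lambda>p. f y x (p - Suc l * n)) i"
    unfolding emb_def sum_subtractf[symmetric]
    by (intro sum.cong refl) (subst br, auto simp: of_rat_diff algebra_simps)
  also have "\<dots> = emb 0 x i * emb l y i - emb 0 y i * emb l x i"
    by (subst (1 2) *) auto
  finally show ?thesis .
qed

lemma s_less: "i < n \<Longrightarrow> s i < n"
  using bij_s by (auto simp: bij_betw_def)

lemma emb_eq_0_imp_block:
  assumes "\<forall>i<n. emb k x i = 0" "j < n"
  shows "x (k * n + j) = 0"
  using E_inj[of "\<lambda>j. of_rat (x (k * n + j))"] assms by (auto simp: emb_def)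

lemma emb_diff: "emb k (\<lambda>p. x p - y p) i = emb k x i - emb k y i"
  by (simp add: emb_def of_rat_diff algebra_simps sum_subtractf)

lemma emb_add: "emb k (\<lambda>p. x p + y p) i = emb k x i + emb k y i"
  by (simp add: emb_def of_rat_add algebra_simps sum.distrib)

lemma emb_scale: "emb k (\<lambda>p. a * x p) i = of_rat a * emb k x i"
  by (simp add: emb_def of_rat_mult sum_distrib_left algebra_simps)

lemma emb_sum: "emb k (\<Sum>a\<in>A. f a) i = (\<Sum>a\<in>A. emb k (f a) i)"
proof (induction A rule: infinite_finite_induct)
  case (insert a A)
  then show ?case using emb_add[of k "f a" "sum f A" i] by (simp add: plus_fun_def)
qed (simp_all add: emb_def zero_fun_def)

text \<open>The columns of \<open>E\<close> are independent even over the reals, so a vector is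
  determined by the embeddings of its levels. Together with \<open>eqI\<close> this reduces all
  identities below to real arithmetic.\<close>

lemma eq_0I:
  assumes "x \<in> qvecs (c * n)" "\<And>k i. k < c \<Longrightarrow> i < n \<Longrightarrow> emb k x i = 0"
  shows "x = (\<lambda>_. 0)"
proof
  fix p
  show "x p = 0"
  proof (cases "p < c * n")
    case True
    then have "p div n < c" "p mod n < n"
      by (simp_all add: less_mult_imp_div_less) (cases n; simp)
    then show ?thesis
      using emb_eq_0_imp_block[of "p div n" x "p mod n"] assms(2) by simp
  qed (use assms in \<open>simp add: qvecs_def\<close>)
qed

lemma eqI:
  assumes "x \<in> qvecs (c * n)" "y \<in> qvecs (c * n)"
    "\<And>k i. k < c \<Longrightarrow> i < n \<Longrightarrow> emb k x i = emb k y i"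
  shows "x = y"
proof -
  have "(\<lambda>p. x p - y p) = (\<lambda>_. 0)"
    using assms by (intro eq_0I) (auto simp: emb_diff qvecs_def)
  then show ?thesis by (auto simp: fun_eq_iff)
qed

lemma emb_bracket:
  assumes "k < c" "i < n"
  shows "emb k (bracket (c * n) lie_const x y) i =
    (if k = 0 then 0
     else if k = 1 then emb 0 x i * emb 0 y (s i) - emb 0 x (s i) * emb 0 y i
     else emb 0 x i * emb (k - 1) y i - emb 0 y i * emb (k - 1) x i)"
  using assms emb_bracket_0 emb_bracket_1 emb_bracket_Suc s_less
  by (cases k rule: level_cases) auto

text \<open>Brackets have no level 0 part, so double brackets vanish in levels 0 and 1. In level
  \<open>k \<ge> 2\<close> the Jacobi sum is a 3 by 3 determinant with two rows equal to the level 0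
  values of \<open>x\<close>, \<open>y\<close>, \<open>z\<close>; the third row holds their values
  at \<open>s i\<close> if \<open>k = 2\<close>, and their level \<open>k - 2\<close> values
  otherwise.\<close>

lemma lie_algebra: "is_lie_algebra (c * n) lie_const"
  unfolding is_lie_algebra_def
proof (intro conjI ballI)
  fix x y z
  show "bracket (c * n) lie_const x x = (\<lambda>_. 0)"
    by (rule eq_0I[of _ c]) (auto simp: bracket_in_qvecs emb_bracket)
  let ?J = "\<lambda>k. bracket (c * n) lie_const x (bracket (c * n) lie_const y z) k
     + bracket (c * n) lie_const y (bracket (c * n) lie_const z x) k
     + bracket (c * n) lie_const z (bracket (c * n) lie_const x y) k"
  have "?J \<in> qvecs (c * n)"
    by (auto simp: qvecs_def bracket_def)
  moreover have "emb k ?J i = 0" if "k < c" "i < n" for k i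
    using that s_less[of i]
    by (cases k rule: level_cases) (auto simp: emb_add emb_bracket algebra_simps)
  ultimately show "?J = (\<lambda>_. 0)" by (rule eq_0I)
qed

section \<open>The lower central series\<close>

lemma emb_unit_fun:
  assumes "j < n" "i < n"
  shows "emb k (unit_fun (l * n + j)) i = (if k = l then E i j else 0)"
proof -
  have "k * n + j' = l * n + j \<longleftrightarrow> k = l \<and> j' = j" if "j' < n" for j'
  proof
    assume eq: "k * n + j' = l * n + j"
    have "(k * n + j') div n = k" "(l * n + j) div n = l" using that assms by simp_all
    with eq show "k = l \<and> j' = j" by simp
  qed simp
  then have "emb k (unit_fun (l * n + j)) i = (\<Sum>j'<n. if k = l \<and> j' = j then E i j' else 0)"
    unfolding emb_def unit_fun_def by (intro sum.cong refl) auto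
  also have "\<dots> = (if k = l then E i j else 0)" using assms by simp
  finally show ?thesis .
qed

lemma emb_tail:
  assumes "x \<in> tail_vecs (m * n) (c * n)" "k < m"
  shows "emb k x i = 0"
  using assms block_index_less[of k m] by (simp add: emb_def tail_vecs_def)

text \<open>Level 0 of a bracket vanishes, and level \<open>k\<close> with
  \<open>1 \<le> k \<le> m\<close> involves \<open>y\<close> only through its levels 0 and
  \<open>k - 1\<close>, both below \<open>m\<close>.\<close>

lemma bracket_in_tail:
  assumes y: "y \<in> tail_vecs (m * n) (c * n)" and m: "Suc m \<le> c"
  shows "bracket (c * n) lie_const x y \<in> tail_vecs (Suc m * n) (c * n)"
proof -
  have "bracket (c * n) lie_const x y p = 0" if p: "p < Suc m * n" for p
  proof -
    have pm: "p div n < Suc m" "p mod n < n"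
      using p less_mult_imp_div_less[OF p] by (simp_all del: mult_Suc) (cases n; simp)
    have "emb (p div n) (bracket (c * n) lie_const x y) i = 0" if "i < n" for i
      using pm m that s_less[OF that]
      by (cases "p div n" rule: level_cases) (auto simp: emb_bracket emb_tail[OF y])
    then show ?thesis
      using emb_eq_0_imp_block[of "p div n" "bracket (c * n) lie_const x y" "p mod n"] pm by simp
  qed
  then show ?thesis by (auto simp: tail_vecs_def bracket_in_qvecs)
qed

lemma unit_fun_in_span_brackets:
  assumes m: "Suc m * n \<le> p" "p < c * n"
  shows "unit_fun p \<in> qfun.span {bracket (c * n) lie_const x y | x y.
    x \<in> qvecs (c * n) \<and> y \<in> tail_vecs (m * n) (c * n)}" (is "_ \<in> qfun.span ?S")
proof -
  let ?br = "bracket (c * n) lie_const"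
  define l j where "l = p div n" and "j = p mod n"
  have n: "0 < n" using m by (cases n) auto
  have p: "p = l * n + j" and j: "j < n" and l: "l < c" "Suc m \<le> l"
    using m(2) n div_le_mono[OF m(1), of n] by (simp_all add: l_def j_def less_mult_imp_div_less)
  have p_q: "unit_fun p \<in> qvecs (c * n)" using m by (simp add: qvecs_def unit_fun_def)
  have c0: "0 < c" using l by simp
  show ?thesis
  proof (cases "l = 1")
    case True
    obtain r where r: "\<forall>i<n. E i j =
      (\<Sum>a<n. \<Sum>b<n. of_rat (r a b) * (E i a * E (s i) b - E (s i) a * E i b))"
      using skew_span[OF j] by blast
    \<comment> \<open>Level 1 is reached only for \<open>m = 0\<close>, where both factors may be
      arbitrary; \<open>skew_span\<close> then writes the basis element as a rational combination of
      skew products.\<close>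
    let ?v = "\<Sum>a<n. \<Sum>b<n. (\<lambda>q. r a b * ?br (unit_fun a) (unit_fun b) q)"
    have unit_q: "unit_fun a \<in> qvecs (c * n)" if "a < n" for a
      using that block_index_less[of 0 c a n] c0 by (auto simp: qvecs_def unit_fun_def)
    have v_span: "?v \<in> qfun.span ?S"
      using True l
      by (intro qfun.span_sum qfun.span_scale qfun.span_base) (auto simp: tail_vecs_def intro!: unit_q)
    have "?v \<in> qvecs (c * n)"
      by (simp add: qvecs_def sum_fun_apply bracket_def)
    moreover have "emb k (unit_fun p) i = emb k ?v i" if "k < c" "i < n" for k i
    proof -
      have e: "emb k' (unit_fun a) i' = (if k' = 0 then E i' a else 0)" if "a < n" "i' < n" for a k' i'
        using emb_unit_fun[of a i' k' 0] that by simp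
      have "emb k ?v i = (\<Sum>a<n. \<Sum>b<n. if k = 1 then
          of_rat (r a b) * (E i a * E (s i) b - E (s i) a * E i b) else 0)"
        unfolding emb_sum emb_scale
        using that s_less[of i]
        by (intro sum.cong refl) (auto simp: emb_bracket e)
      also have "\<dots> = (if k = 1 then E i j else 0)"
        using r that by auto
      also have "\<dots> = emb k (unit_fun p) i"
        unfolding p emb_unit_fun[OF j that(2)] using True by simp
      finally show ?thesis by simp
    qed
    ultimately have "unit_fun p = ?v" by (intro eqI[of _ c] p_q)
    with v_span show ?thesis by simp
  next
    case False
    define k where "k = l - 1"
    have k: "l = Suc k" "k \<noteq> 0" "m \<le> k" using False l by (auto simp: k_def)
    \<comment> \<open>\<open>w\<close> is the element 1 of the order, placed in level 0: bracketing
      with it moves level \<open>k \<ge> 1\<close> identically onto level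
      \<open>k + 1\<close>.\<close>
    define w where "w q = (if q < n then of_int (lattice_coord n E (\<lambda>_. 1) q) else 0 :: rat)" for q
    have "\<not> q < n" if "c * n \<le> q" for q
      using that c0 by (cases c) auto
    then have w_q: "w \<in> qvecs (c * n)"
      by (auto simp: qvecs_def w_def)
    have w_emb: "emb 0 w i = 1" if "i < n" for i
      using lattice_coord[OF one that] by (simp add: emb_def w_def)
    let ?y = "unit_fun (k * n + j)"
    have "m * n \<le> k * n + j" using k(3) by (simp add: trans_le_add1)
    then have y: "?y \<in> tail_vecs (m * n) (c * n)"
      using l k j by (intro unit_fun_in_tail block_index_less) auto
    have w_emb0: "emb k' w i = 0" if "0 < k'" for i k'
    proof -
      have "\<not> k' * n + j' < n" if "j' < n" for j'
        using \<open>0 < k'\<close> by (cases k') auto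
      then show ?thesis by (simp add: emb_def w_def)
    qed
    have "unit_fun p = ?br w ?y"
    proof (rule eqI[of _ c])
      fix k' i assume k': "k' < c" "i < n"
      have "emb k' (unit_fun p) i = (if k' = Suc k then E i j else 0)"
        unfolding p k(1) by (rule emb_unit_fun[OF j k'(2)])
      moreover have "emb q ?y i' = (if q = k then E i' j else 0)" if "i' < n" for q i'
        by (rule emb_unit_fun[OF j that])
      ultimately show "emb k' (unit_fun p) i = emb k' (?br w ?y) i"
        using k' s_less[of i] k by (cases k' rule: level_cases) (auto simp: emb_bracket w_emb w_emb0)
    qed (auto simp: p_q bracket_in_qvecs)
    moreover have "?br w ?y \<in> ?S" using w_q y by blast
    ultimately show ?thesis by (simp only: qfun.span_base)
  qed
qed

text \<open>The two inclusions are \<open>bracket_in_tail\<close> and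
  \<open>unit_fun_in_span_brackets\<close>. The series is counted from 1 and the levels from 0,
  hence \<open>Suc m\<close>; the case \<open>m = c\<close> gives the zero space.\<close>

lemma lcs_eq_tail:
  assumes "m \<le> c"
  shows "lcs (c * n) lie_const (Suc m) = tail_vecs (m * n) (c * n)"
  using assms
proof (induction m)
  case 0
  then show ?case by (simp add: tail_vecs_def)
next
  case (Suc m)
  let ?S = "{bracket (c * n) lie_const x y | x y.
    x \<in> qvecs (c * n) \<and> y \<in> tail_vecs (m * n) (c * n)}"
  have "lcs (c * n) lie_const (Suc (Suc m)) = qfun.span ?S"
    using Suc by (simp add: qspan_eq_span)
  also have "\<dots> = tail_vecs (Suc m * n) (c * n)"
  proof
    show "qfun.span ?S \<subseteq> tail_vecs (Suc m * n) (c * n)"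
      using Suc.prems by (intro qfun.span_minimal subspace_tail_vecs) (auto intro!: bracket_in_tail simp del: mult_Suc)
    show "tail_vecs (Suc m * n) (c * n) \<subseteq> qfun.span ?S"
      by (rule tail_vecs_subset_span) (rule unit_fun_in_span_brackets)
  qed
  finally show ?case .
qed

lemma nilpotency_class:
  assumes "0 < c" "0 < n"
  shows "nilpotency_class (c * n) lie_const c"
proof -
  have "lcs (c * n) lie_const (c + 1) = {\<lambda>_. 0}"
    using lcs_eq_tail[of c c] by (auto simp: tail_vecs_def qvecs_def fun_eq_iff) (metis not_le)
  moreover have "unit_fun ((c - 1) * n) \<in> lcs (c * n) lie_const c"
    using lcs_eq_tail[of "c - 1" c] assms by (simp add: unit_fun_in_tail)
  moreover have "unit_fun ((c - 1) * n) \<noteq> (\<lambda>_. 0)"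
    by (metis unit_fun_def zero_neq_one)
  ultimately show ?thesis by (auto simp: nilpotency_class_def)
qed

lemma has_type: "has_type (c * n) lie_const c (replicate c n)"
  unfolding has_type_def
proof (intro conjI ballI)
  fix i assume "i \<in> {1..c}"
  then obtain m where m: "i = Suc m" "m < c" by (cases i) auto
  \<comment> \<open>This bound keeps the truncated subtraction in the dimensions
    \<open>c * n - m * n\<close> and \<open>c * n - Suc m * n\<close> exact, so that they differ by
    \<open>n\<close>.\<close>
  have "Suc m * n \<le> c * n" using m by (intro mult_le_mono1) simp
  then show "qdim (lcs (c * n) lie_const i) - qdim (lcs (c * n) lie_const (i + 1)) = replicate c n ! (i - 1)"
    using m lcs_eq_tail[of m c] lcs_eq_tail[of "Suc m" c] by (simp add: qdim_tail_vecs)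
qed simp

section \<open>The automorphism given by the unit\<close>

lemma weight_in_lattice:
  assumes "j < n"
  shows "in_lattice n E (\<lambda>i. weight k i * E i j)"
proof (cases "k = 0")
  case False
  \<comment> \<open>Starting from \<open>unit_s\<close>, the factors \<open>u i\<close> are
    multiplied on one at a time.\<close>
  have "in_lattice n E (\<lambda>i. u i ^ k * (u (s i) * E i j))" for k
  proof (induction k)
    case (Suc k)
    from in_lattice_mult[OF unit this] show ?case by (simp add: mult.assoc)
  qed (use unit_s[OF assms] in simp)
  with False show ?thesis by (simp add: weight_def mult.assoc)
qed (use unit[OF assms] in \<open>simp add: weight_def\<close>)

abbreviation weight_coord :: "nat \<Rightarrow> nat \<Rightarrow> nat \<Rightarrow> int" where
  "weight_coord k j \<equiv> lattice_coord n E (\<lambda>i. weight k i * E i j)"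

lemma weight_coord: "i < n \<Longrightarrow> j < n \<Longrightarrow>
    (\<Sum>l<n. of_int (weight_coord k j l) * E i l) = weight k i * E i j"
  by (rule lattice_coord[OF weight_in_lattice])

lemma unit_mat_block:
  assumes "k < c" "k' < c" "j < n" "j' < n"
  shows "unit_mat (c * n) $$ (k * n + j, k' * n + j') = (if k = k' then weight_coord k j' j else 0)"
proof -
  have "(k * n + j) div n = k" "(k' * n + j') div n = k'" using assms by simp_all
  then show ?thesis
    using assms block_index_less[of k c j n] block_index_less[of k' c j' n]
    by (simp add: unit_mat_def)
qed

lemma emb_mat_act:
  assumes "k < c" "i < n"
  shows "emb k (mat_act (c * n) (map_mat of_int (unit_mat (c * n))) x) i = weight k i * emb k x i"
proof -
  have act: "mat_act (c * n) (map_mat of_int (unit_mat (c * n))) x (k * n + j)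
      = (\<Sum>j'<n. of_int (weight_coord k j' j) * x (k * n + j'))" if "j < n" for j
  proof -
    have "unit_mat (c * n) \<in> carrier_mat (c * n) (c * n)" by (simp add: unit_mat_def)
    then have "mat_act (c * n) (map_mat of_int (unit_mat (c * n))) x (k * n + j)
      = (\<Sum>k'<c. \<Sum>j'<n. of_int (unit_mat (c * n) $$ (k * n + j, k' * n + j')) * x (k' * n + j'))"
      using block_index_less[OF assms(1) that] block_index_less[of _ c _ n]
      by (simp add: mat_act_def sum_lessThan_mult cong: sum.cong_simp)
    also have "\<dots> = (\<Sum>k'<c. \<Sum>j'<n. if k = k' then of_int (weight_coord k' j' j) * x (k' * n + j') else 0)"
      using assms that by (intro sum.cong refl) (simp add: unit_mat_block)
    finally show ?thesis using sum_block_only[OF assms(1)] by simp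
  qed
  have "emb k (mat_act (c * n) (map_mat of_int (unit_mat (c * n))) x) i
      = (\<Sum>j<n. \<Sum>j'<n. of_rat (x (k * n + j')) * (of_int (weight_coord k j' j) * E i j))"
    unfolding emb_def
    by (intro sum.cong refl) (simp add: act of_rat_sum of_rat_mult sum_distrib_right mult.assoc mult.left_commute)
  also have "\<dots> = (\<Sum>j'<n. \<Sum>j<n. of_rat (x (k * n + j')) * (of_int (weight_coord k j' j) * E i j))"
    by (rule sum.swap)
  also have "\<dots> = (\<Sum>j'<n. of_rat (x (k * n + j')) * (weight k i * E i j'))"
    by (simp add: weight_coord assms flip: sum_distrib_left)
  also have "\<dots> = weight k i * emb k x i"
    by (simp add: emb_def sum_distrib_left algebra_simps)
  finally show ?thesis .
qed

section \<open>Determinant and eigenvalues of the automorphism\<close>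

definition basis_mat :: "nat \<Rightarrow> real mat" where
  "basis_mat d = mat d d (\<lambda>(p, q). if p div n = q div n then E (p mod n) (q mod n) else 0)"

lemma basis_mat_block:
  assumes "k < c" "k' < c" "j < n" "j' < n"
  shows "basis_mat (c * n) $$ (k * n + j, k' * n + j') = (if k = k' then E j j' else 0)"
proof -
  have "(k * n + j) div n = k" "(k' * n + j') div n = k'" using assms by simp_all
  then show ?thesis
    using assms block_index_less[of k c j n] block_index_less[of k' c j' n]
    by (simp add: basis_mat_def)
qed

text \<open>The matrix consists of \<open>c\<close> diagonal copies of \<open>E\<close>. Each block
  of a kernel vector is a real relation between the columns of \<open>E\<close>, hence zero by
  \<open>E_inj\<close>.\<close>

lemma det_basis_mat: "det (basis_mat (c * n)) \<noteq> 0"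
proof
  let ?B = "basis_mat (c * n)"
  have B: "?B \<in> carrier_mat (c * n) (c * n)" by (simp add: basis_mat_def)
  assume "det ?B = 0"
  then obtain v where v: "v \<in> carrier_vec (c * n)" "v \<noteq> 0\<^sub>v (c * n)" "?B *\<^sub>v v = 0\<^sub>v (c * n)"
    using det_0_iff_vec_prod_zero[OF B] by auto
  have "v $ p = 0" if p: "p < c * n" for p
  proof -
    obtain k j where kj: "p = k * n + j" "k < c" "j < n" using block_obtain[OF p] .
    have "(\<Sum>j<n. v $ (k * n + j) * E i j) = 0" if i: "i < n" for i
    proof -
      have "0 = (?B *\<^sub>v v) $ (k * n + i)"
        using v(3) block_index_less[OF kj(2) i] by simp
      also have "\<dots> = (\<Sum>q<c * n. ?B $$ (k * n + i, q) * v $ q)"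
        using v(1) B block_index_less[OF kj(2) i] by (simp add: scalar_prod_def lessThan_atLeast0)
      also have "\<dots> = (\<Sum>k'<c. \<Sum>j<n. if k = k' then E i j * v $ (k' * n + j) else 0)"
        unfolding sum_lessThan_mult using kj i by (intro sum.cong refl) (simp add: basis_mat_block)
      also have "\<dots> = (\<Sum>j<n. v $ (k * n + j) * E i j)"
        using sum_block_only[OF kj(2)] by (simp add: mult.commute)
      finally show ?thesis by simp
    qed
    then show ?thesis using E_inj[of "\<lambda>j. v $ (k * n + j)"] kj by simp
  qed
  with v(1,2) show False by (metis carrier_vecD eq_vecI index_zero_vec(1) index_zero_vec(2))
qed

abbreviation weight_diag :: "nat \<Rightarrow> real mat" where
  "weight_diag d \<equiv> mat_diag d (\<lambda>p. weight (p div n) (p mod n))"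

text \<open>Matrix form of \<open>weight_coord\<close>: the rows of \<open>basis_mat\<close> are
  left eigenvectors of the automorphism, with the weights as eigenvalues.\<close>

lemma basis_mat_unit_mat:
  "basis_mat (c * n) * map_mat of_int (unit_mat (c * n)) = weight_diag (c * n) * basis_mat (c * n)"
  (is "?B * ?A = _")
proof (rule eq_matI)
  have B: "?B \<in> carrier_mat (c * n) (c * n)" by (simp add: basis_mat_def)
  have A: "?A \<in> carrier_mat (c * n) (c * n)" by (simp add: unit_mat_def)
  fix p q assume "p < dim_row (weight_diag (c * n) * ?B)" "q < dim_col (weight_diag (c * n) * ?B)"
  then have pq: "p < c * n" "q < c * n" using B by (simp_all add: mat_diag_def)
  obtain k j where kj: "p = k * n + j" "k < c" "j < n" using block_obtain[OF pq(1)] .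
  obtain k' j' where kj': "q = k' * n + j'" "k' < c" "j' < n" using block_obtain[OF pq(2)] .
  have div: "p div n = k" "p mod n = j" using kj by simp_all
  have "(?B * ?A) $$ (p, q) = (\<Sum>r<c * n. ?B $$ (p, r) * ?A $$ (r, q))"
    using A B pq by (simp add: scalar_prod_def lessThan_atLeast0)
  also have "\<dots> = (\<Sum>l<c. \<Sum>i<n. if k = l then (if k = k' then of_int (weight_coord k j' i) * E j i else 0) else 0)"
    unfolding sum_lessThan_mult
  proof (intro sum.cong refl)
    fix l i assume "l \<in> {..<c}" "i \<in> {..<n}"
    then have li: "l < c" "i < n" by simp_all
    have "?A $$ (l * n + i, q) = of_int (unit_mat (c * n) $$ (l * n + i, q))"
      using A pq block_index_less[OF li] by (simp add: unit_mat_def)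
    then show "?B $$ (p, l * n + i) * ?A $$ (l * n + i, q)
      = (if k = l then (if k = k' then of_int (weight_coord k j' i) * E j i else 0) else 0)"
      using kj kj' li by (simp add: basis_mat_block unit_mat_block)
  qed
  also have "\<dots> = (\<Sum>i<n. if k = k' then of_int (weight_coord k j' i) * E j i else 0)"
    by (rule sum_block_only[OF kj(2)])
  also have "\<dots> = (if k = k' then weight k j * E j j' else 0)"
    using kj kj' by (simp add: weight_coord)
  also have "\<dots> = weight k j * ?B $$ (p, q)"
    using kj kj' by (simp add: basis_mat_block)
  also have "\<dots> = (weight_diag (c * n) * ?B) $$ (p, q)"
    using pq B by (simp add: mat_diag_mult_left[OF B] div)
  finally show "(?B * ?A) $$ (p, q) = (weight_diag (c * n) * ?B) $$ (p, q)" .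
qed (auto simp: basis_mat_def unit_mat_def mat_diag_def)

lemma similar_weight_diag:
  "similar_mat (map_mat of_int (unit_mat (c * n))) (weight_diag (c * n))"
proof -
  let ?d = "c * n" and ?B = "basis_mat (c * n)" and ?A = "map_mat of_int (unit_mat (c * n)) :: real mat"
  have B: "?B \<in> carrier_mat ?d ?d" by (simp add: basis_mat_def)
  have A: "?A \<in> carrier_mat ?d ?d" by (simp add: unit_mat_def)
  obtain P where P: "P \<in> carrier_mat ?d ?d" "?B * P = 1\<^sub>m ?d" "P * ?B = 1\<^sub>m ?d"
    using mat_inverse_exists[OF B det_basis_mat] .
  have "?A = P * ?B * ?A" using A P by simp
  also have "\<dots> = P * (weight_diag ?d * ?B)"
    using assoc_mult_mat[OF P(1) B A] by (simp add: basis_mat_unit_mat)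
  also have "\<dots> = P * weight_diag ?d * ?B"
    using assoc_mult_mat[OF P(1) mat_diag_dim B] by simp
  finally have "similar_mat_wit ?A (weight_diag ?d) P ?B"
    using A B P by (simp add: similar_mat_wit_def Let_def)
  then show ?thesis by (auto simp: similar_mat_def)
qed

lemma upper_triangular_weight_diag: "upper_triangular (weight_diag d)"
  by (auto simp: mat_diag_def upper_triangular_def)

lemma diag_weight_diag:
  "diag_mat (weight_diag d) = map (\<lambda>p. weight (p div n) (p mod n)) [0..<d]"
  by (auto simp: diag_mat_def mat_diag_def)

text \<open>The permutation \<open>s\<close> only reorders the conjugates of \<open>u\<close>, so
  the product is the power \<open>k + 1\<close> of the norm of \<open>u\<close>.\<close>

lemma prod_weight: "\<bar>\<Prod>i<n. weight k i\<bar> = 1"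
proof -
  have "(\<Prod>i<n. u (s i)) = (\<Prod>i<n. u i)"
    by (rule prod.reindex_bij_betw[OF bij_s])
  then show ?thesis
    using norm_u
    by (cases "k = 0") (simp_all add: weight_def prod.distrib prod_power_distrib[symmetric] abs_mult power_abs)
qed

lemma abs_det_unit_mat: "\<bar>det (unit_mat (c * n))\<bar> = 1"
proof -
  let ?d = "c * n"
  have "real_of_int (det (unit_mat ?d)) = det (weight_diag ?d)"
    using det_similar[OF similar_weight_diag] by (simp add: of_int_hom.hom_det)
  also have "\<dots> = (\<Prod>p<?d. weight (p div n) (p mod n))"
    using det_upper_triangular[OF upper_triangular_weight_diag mat_diag_dim]
    by (simp add: diag_weight_diag prod.list_conv_set_nth lessThan_atLeast0)
  also have "\<bar>\<dots>\<bar> = (\<Prod>k<c. \<bar>\<Prod>j<n. weight k j\<bar>)"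
    unfolding prod_lessThan_mult abs_prod by (intro prod.cong refl) simp
  also have "\<dots> = 1" by (simp add: prod_weight)
  finally have "of_int \<bar>det (unit_mat ?d)\<bar> = (1 :: real)" by simp
  then show ?thesis by linarith
qed

lemma weight_abs: "i < n \<Longrightarrow> \<bar>weight k i\<bar> \<noteq> 1"
  using u_abs u_pow_abs[of i k] by (simp add: weight_def)

text \<open>\<open>hyperbolic\<close> speaks of the rational characteristic polynomial, whereas the
  diagonalization is real. Both polynomials are images of the one of the integer matrix.\<close>

lemma char_poly_hom_unit_mat:
  "map_poly of_rat (char_poly (map_mat rat_of_int (unit_mat d))) =
   (map_poly of_real (char_poly (map_mat real_of_int (unit_mat d))) :: complex poly)"
proof -
  have U: "unit_mat d \<in> carrier_mat d d" by (simp add: unit_mat_def)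
  show ?thesis
    unfolding of_int_hom.char_poly_hom[OF U]
    by (simp add: map_poly_map_poly o_def)
qed

lemma hyperbolic_unit_mat: "hyperbolic (map_mat of_int (unit_mat (c * n)))"
  unfolding hyperbolic_def
proof (intro allI impI)
  fix z :: complex
  assume z: "poly (map_poly of_rat (char_poly (map_mat rat_of_int (unit_mat (c * n))))) z = 0"
  have "char_poly (map_mat real_of_int (unit_mat (c * n)))
      = (\<Prod>a\<leftarrow>diag_mat (weight_diag (c * n)). [:- a, 1:])"
    using char_poly_similar[OF similar_weight_diag]
      char_poly_upper_triangular[OF mat_diag_dim upper_triangular_weight_diag] by simp
  then have "poly (map_poly of_real (\<Prod>a\<leftarrow>diag_mat (weight_diag (c * n)). [:- a, 1:])) z = 0"
    using z by (simp only: char_poly_hom_unit_mat)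
  moreover interpret map_poly_comm_ring_hom complex_of_real ..
  have "poly (map_poly of_real (\<Prod>a\<leftarrow>as. [:- a, 1:])) z = (\<Prod>a\<leftarrow>as. z - of_real a)" for as
    by (induction as) (simp_all add: hom_mult of_real_hom.map_poly_pCons_hom del: mult_pCons_left)
  ultimately have "(\<Prod>a\<leftarrow>diag_mat (weight_diag (c * n)). z - of_real a) = 0" by simp
  \<comment> \<open>Every root is a real weight, so its modulus is the absolute value of that
    weight.\<close>
  then obtain a where a: "a \<in> set (diag_mat (weight_diag (c * n)))" "z = of_real a"
    by (auto simp: prod_list_zero_iff)
  then obtain p where "p < c * n" "a = weight (p div n) (p mod n)"
    by (auto simp: diag_weight_diag)
  moreover from this have "p mod n < n" by (cases n) auto
  ultimately have "\<bar>a\<bar> \<noteq> 1" by (simp add: weight_abs)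
  with a(2) show "cmod z \<noteq> 1" by simp
qed

lemma integer_like_unit_mat: "integer_like (map_mat of_int (unit_mat (c * n)))"
proof -
  have U: "unit_mat (c * n) \<in> carrier_mat (c * n) (c * n)" by (simp add: unit_mat_def)
  have "det (unit_mat (c * n)) = 1 \<or> det (unit_mat (c * n)) = -1"
    using abs_det_unit_mat[of c] by linarith
  then show ?thesis
    by (auto simp: integer_like_def of_int_hom.char_poly_hom[OF U] of_int_hom.hom_det)
qed

text \<open>The action is pointwise scaling by weights, and
  \<open>weight 1 i = u i * u (s i)\<close> and \<open>weight k i = u i * weight (k - 1) i\<close>
  for \<open>k \<ge> 2\<close> match the bracket in each level. Bijectivity comes from the
  determinant.\<close>

lemma automorphism_unit_mat:
  "is_automorphism (c * n) lie_const (map_mat of_int (unit_mat (c * n)))" (is "is_automorphism _ _ ?A")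
  unfolding is_automorphism_def
proof (intro conjI ballI)
  show A: "?A \<in> carrier_mat (c * n) (c * n)" by (simp add: unit_mat_def)
  have "det (unit_mat (c * n)) \<noteq> 0" using abs_det_unit_mat[of c] by auto
  then show "bij_betw (mat_act (c * n) ?A) (qvecs (c * n)) (qvecs (c * n))"
    by (intro bij_betw_mat_act A) (simp add: of_int_hom.hom_det)
  fix x y
  show "mat_act (c * n) ?A (bracket (c * n) lie_const x y)
      = bracket (c * n) lie_const (mat_act (c * n) ?A x) (mat_act (c * n) ?A y)"
  proof (rule eqI[of _ c])
    fix k i assume "k < c" "i < n"
    then show "emb k (mat_act (c * n) ?A (bracket (c * n) lie_const x y)) i
      = emb k (bracket (c * n) lie_const (mat_act (c * n) ?A x) (mat_act (c * n) ?A y)) i"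
      using s_less[of i]
      by (cases k rule: level_cases) (auto simp: emb_mat_act emb_bracket weight_def algebra_simps)
  qed (auto simp: mat_act_in_qvecs bracket_in_qvecs)
qed

theorem anosov_lie_algebra: "anosov (c * n) lie_const"
  unfolding anosov_def
  using automorphism_unit_mat hyperbolic_unit_mat integer_like_unit_mat by blast

end

section \<open>Direct sums of lattices\<close>

definition block_sum :: "nat \<Rightarrow> (nat \<Rightarrow> nat \<Rightarrow> real) \<Rightarrow> (nat \<Rightarrow> nat \<Rightarrow> real) \<Rightarrow> nat \<Rightarrow> nat \<Rightarrow> real" where
  "block_sum m E E' i j =
     (if i < m \<and> j < m then E i j else if m \<le> i \<and> m \<le> j then E' (i - m) (j - m) else 0)"

lemma block_sum_simps [simp]:
  "i < m \<Longrightarrow> j < m \<Longrightarrow> block_sum m E E' i j = E i j"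
  "i < m \<Longrightarrow> block_sum m E E' i (m + j) = 0"
  "j < m \<Longrightarrow> block_sum m E E' (m + i) j = 0"
  "block_sum m E E' (m + i) (m + j) = E' i j"
  by (simp_all add: block_sum_def)

lemma less_add_cases:
  fixes i m n :: nat
  assumes "i < m + n"
  obtains "i < m" | i' where "i = m + i'" "i' < n"
  using assms by (metis add_diff_inverse_nat nat_add_left_cancel_less)

lemma in_lattice_block_sum:
  assumes "in_lattice m E v" "in_lattice n E' v'"
    and eq: "\<And>i. i < m \<Longrightarrow> w i = v i" "\<And>i. i < n \<Longrightarrow> w (m + i) = v' i"
  shows "in_lattice (m + n) (block_sum m E E') w"
proof -
  from assms obtain z z' where z: "\<forall>i<m. v i = (\<Sum>j<m. of_int (z j) * E i j)"
    and z': "\<forall>i<n. v' i = (\<Sum>j<n. of_int (z' j) * E' i j)"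
    by (auto simp: in_lattice_def)
  have "w i = (\<Sum>j<m + n. of_int (if j < m then z j else z' (j - m)) * block_sum m E E' i j)"
    if "i < m + n" for i
    using that by (cases rule: less_add_cases) (simp_all add: sum_lessThan_add eq z z')
  then show ?thesis
    unfolding in_lattice_def by (intro exI[of _ "\<lambda>j. if j < m then z j else z' (j - m)"]) blast
qed

lemma bij_betw_lessThan_add:
  fixes s s' :: "nat \<Rightarrow> nat"
  assumes "bij_betw s {..<m} {..<m}" "bij_betw s' {..<n} {..<n}"
  shows "bij_betw (\<lambda>i. if i < m then s i else m + s' (i - m)) {..<m + n} {..<m + n}"
proof -
  let ?t = "\<lambda>i. if i < m then s i else m + s' (i - m)"
  have lt: "i < m \<Longrightarrow> s i < m" "i < n \<Longrightarrow> s' i < n" for i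
    using assms by (auto simp: bij_betw_def)
  have "inj_on ?t {..<m + n}"
  proof (rule inj_onI)
    fix i j assume "i \<in> {..<m + n}" "j \<in> {..<m + n}" and eq: "?t i = ?t j"
    then have "i < m + n" "j < m + n" by simp_all
    then show "i = j"
      using eq lt assms[unfolded bij_betw_def inj_on_def]
      by (elim less_add_cases[of i] less_add_cases[of j]) (auto, (metis lt(1) not_add_less1)+)
  qed
  moreover have "?t ` {..<m + n} \<subseteq> {..<m + n}"
    using lt by (auto elim!: less_add_cases simp: trans_less_add1)
  ultimately show ?thesis
    unfolding bij_betw_def by (simp only: endo_inj_surj finite_lessThan)
qed

text \<open>The permutation respects the two blocks, so products and skew products of basis elements
  from different summands vanish. Every condition can then be checked blockwise, and the norms
  multiply.\<close>

lemma unit_lattice_add: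
  assumes "unit_lattice m E s u" "unit_lattice n E' s' u'"
  shows "unit_lattice (m + n) (block_sum m E E')
    (\<lambda>i. if i < m then s i else m + s' (i - m)) (\<lambda>i. if i < m then u i else u' (i - m))"
    (is "unit_lattice _ ?E ?s ?u")
proof -
  interpret A: unit_lattice m E s u by fact
  interpret B: unit_lattice n E' s' u' by fact
  have lt: "i < m \<Longrightarrow> s i < m" "i < n \<Longrightarrow> s' i < n" for i
    using A.bij_s B.bij_s by (auto simp: bij_betw_def)
  note zero = in_lattice_zero
  show ?thesis
  proof
    show "bij_betw ?s {..<m + n} {..<m + n}"
      using A.bij_s B.bij_s by (rule bij_betw_lessThan_add)
    show "\<forall>j<m + n. z j = 0" if z: "\<forall>i<m + n. (\<Sum>j<m + n. z j * ?E i j) = 0" for z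
    proof -
      have "(\<Sum>j<m. z j * E i j) = 0" if "i < m" for i
        using z[rule_format, of i] that by (simp add: sum_lessThan_add)
      moreover have "(\<Sum>j<n. z (m + j) * E' i j) = 0" if "i < n" for i
        using z[rule_format, of "m + i"] that by (simp add: sum_lessThan_add)
      ultimately show ?thesis
        using A.E_inj[of z] B.E_inj[of "\<lambda>j. z (m + j)"] by (auto elim: less_add_cases)
    qed
    show "in_lattice (m + n) ?E (\<lambda>_. 1)"
      by (rule in_lattice_block_sum[OF A.one B.one]) simp_all
    fix k assume k: "k < m + n"
    show "in_lattice (m + n) ?E (\<lambda>i. ?u i * ?E i k)"
      using k
      by (elim less_add_cases)
        (auto intro: in_lattice_block_sum[OF A.unit zero] in_lattice_block_sum[OF zero B.unit])
    show "in_lattice (m + n) ?E (\<lambda>i. ?u (?s i) * ?E i k)"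
      using k lt
      by (elim less_add_cases)
        (auto intro: in_lattice_block_sum[OF A.unit_s zero] in_lattice_block_sum[OF zero B.unit_s])
    show "in_lattice (m + n) ?E (\<lambda>i. ?E i j * ?E i k)" if "j < m + n" for j
      using k that
      by (elim less_add_cases[of j] less_add_cases[of k])
        (auto intro: in_lattice_block_sum[OF A.mult zero] in_lattice_block_sum[OF zero B.mult]
          in_lattice_block_sum[OF zero zero])
    show "in_lattice (m + n) ?E (\<lambda>i. ?E i j * ?E (?s i) k - ?E (?s i) j * ?E i k)" if "j < m + n" for j
      using k that lt
      by (elim less_add_cases[of j] less_add_cases[of k])
        (auto intro: in_lattice_block_sum[OF A.skew zero] in_lattice_block_sum[OF zero B.skew]
          in_lattice_block_sum[OF zero zero])
    from k show "\<exists>r. \<forall>i<m + n. ?E i k =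
      (\<Sum>a<m + n. \<Sum>b<m + n. of_rat (r a b) * (?E i a * ?E (?s i) b - ?E (?s i) a * ?E i b))"
    proof (cases rule: less_add_cases)
      case 1
      obtain r where r: "\<forall>i<m. E i k =
        (\<Sum>a<m. \<Sum>b<m. of_rat (r a b) * (E i a * E (s i) b - E (s i) a * E i b))"
        using A.skew_span[OF 1] by blast
      show ?thesis
      proof (intro exI[of _ "\<lambda>a b. if a < m \<and> b < m then r a b else 0"] allI impI)
        fix i assume "i < m + n"
        then show "?E i k = (\<Sum>a<m + n. \<Sum>b<m + n. of_rat (if a < m \<and> b < m then r a b else 0) *
            (?E i a * ?E (?s i) b - ?E (?s i) a * ?E i b))"
          by (cases rule: less_add_cases) (use 1 r lt in \<open>simp_all add: sum_lessThan_add\<close>)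
      qed
    next
      case (2 k')
      obtain r where r: "\<forall>i<n. E' i k' =
        (\<Sum>a<n. \<Sum>b<n. of_rat (r a b) * (E' i a * E' (s' i) b - E' (s' i) a * E' i b))"
        using B.skew_span[OF 2(2)] by blast
      show ?thesis
      proof (intro exI[of _ "\<lambda>a b. if m \<le> a \<and> m \<le> b then r (a - m) (b - m) else 0"] allI impI)
        fix i assume "i < m + n"
        then show "?E i k = (\<Sum>a<m + n. \<Sum>b<m + n.
            of_rat (if m \<le> a \<and> m \<le> b then r (a - m) (b - m) else 0) *
            (?E i a * ?E (?s i) b - ?E (?s i) a * ?E i b))"
          by (cases rule: less_add_cases) (use 2 r lt in \<open>simp_all add: sum_lessThan_add\<close>)
      qed
    qed
    show "\<bar>?u k\<bar> \<noteq> 1"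
      using k A.u_abs B.u_abs by (elim less_add_cases) auto
    show "\<bar>?u k ^ l * ?u (?s k)\<bar> \<noteq> 1" if "1 \<le> l" for l
      using k lt A.u_pow_abs[OF _ that] B.u_pow_abs[OF _ that] by (elim less_add_cases) auto
  next
    show "\<bar>\<Prod>i<m + n. ?u i\<bar> = 1"
      using A.norm_u B.norm_u by (simp add: prod_lessThan_add abs_mult)
  qed
qed

section \<open>Orbits of squaring minus two\<close>

text \<open>The order is generated by one unit, with its powers as basis; the points
  \<open>x i\<close> are its conjugates, and squaring minus two acts on them as a cyclic shift.
  Lattice membership follows from stability under multiplication by \<open>x\<close>.\<close>

lemma unit_lattice_orbit:
  fixes x :: "nat \<Rightarrow> real" and q :: "nat \<Rightarrow> int"
  assumes n: "0 < n" and inj: "inj_on x {..<n}"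
    and root: "\<And>i. i < n \<Longrightarrow> x i ^ n = (\<Sum>j<n. of_int (q j) * x i ^ j)"
    and step: "\<And>i. x (Suc i) = (x i)\<^sup>2 - 2" and period: "x n = x 0"
    and span: "\<And>k. k < n \<Longrightarrow> \<exists>r. \<forall>i<n. x i ^ k = (\<Sum>a<n. \<Sum>b<n. of_rat (r a b) *
      (x i ^ a * ((x i)\<^sup>2 - 2) ^ b - ((x i)\<^sup>2 - 2) ^ a * x i ^ b))"
    and norm: "\<bar>\<Prod>i<n. x i\<bar> = 1"
    and abs: "\<And>i. i < n \<Longrightarrow> \<bar>x i\<bar> \<noteq> 1"
    and pow_abs: "\<And>i k. i < n \<Longrightarrow> 1 \<le> k \<Longrightarrow> \<bar>x i\<bar> ^ k * \<bar>x (Suc i)\<bar> \<noteq> 1"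
  shows "unit_lattice n (\<lambda>i j. x i ^ j) (\<lambda>i. Suc i mod n) x"
proof -
  let ?E = "\<lambda>i j. x i ^ j"
  \<comment> \<open>The index wraps around at \<open>i = n - 1\<close>, where \<open>period\<close>
    supplies the value.\<close>
  have shift: "x (Suc i mod n) = (x i)\<^sup>2 - 2" if "i < n" for i
    using that step[of i] period by (cases "Suc i = n") auto
  have times_x: "in_lattice n ?E (\<lambda>i. x i * v i)" if "in_lattice n ?E v" for v
  proof (rule in_lattice_mult[OF _ that])
    fix j assume j: "j < n"
    show "in_lattice n ?E (\<lambda>i. x i * x i ^ j)"
    proof (cases "Suc j = n")
      case True
      \<comment> \<open>The power \<open>n\<close> leaves the basis and is reduced by the monic
        integer relation \<open>root\<close>.\<close>
      have "in_lattice n ?E (\<lambda>i. \<Sum>j<n. of_int (q j) * x i ^ j)"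
        by (intro in_lattice_sum in_lattice_scale in_lattice_basis) simp
      then show ?thesis
        by (rule in_lattice_cong) (use True root in \<open>auto simp flip: power_Suc\<close>)
    next
      case False
      then show ?thesis using in_lattice_basis[of "Suc j" n ?E] j by simp
    qed
  qed
  have times_power: "in_lattice n ?E (\<lambda>i. x i ^ k * v i)" if "in_lattice n ?E v" for v k
    by (induction k) (use that in \<open>simp_all add: times_x mult.assoc\<close>)
  have times_g: "in_lattice n ?E (\<lambda>i. ((x i)\<^sup>2 - 2) * v i)" if "in_lattice n ?E v" for v
    using in_lattice_add[OF times_power[OF that, of 2] in_lattice_scale[OF that, of "-2"]]
    by (simp add: algebra_simps)
  have times_g_power: "in_lattice n ?E (\<lambda>i. ((x i)\<^sup>2 - 2) ^ k * v i)" if "in_lattice n ?E v" for v k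
    by (induction k) (use that in \<open>simp_all add: times_g mult.assoc\<close>)
  have one: "in_lattice n ?E (\<lambda>_. 1)"
    using in_lattice_basis[OF n, of ?E] by simp
  have power: "in_lattice n ?E (\<lambda>i. x i ^ k)" for k
    using times_power[OF one] by simp
  show ?thesis
  proof
    have "(\<lambda>i. Suc i mod n) ` {..<n} \<subseteq> {..<n}" using n by auto
    moreover have "inj_on (\<lambda>i. Suc i mod n) {..<n}"
    proof (rule inj_onI)
      fix i j assume "i \<in> {..<n}" "j \<in> {..<n}" "Suc i mod n = Suc j mod n"
      then show "i = j" by (cases "Suc i = n"; cases "Suc j = n") auto
    qed
    ultimately show "bij_betw (\<lambda>i. Suc i mod n) {..<n} {..<n}"
      unfolding bij_betw_def by (simp only: endo_inj_surj finite_lessThan)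
    show "\<forall>j<n. z j = 0" if z: "\<forall>i<n. (\<Sum>j<n. z j * x i ^ j) = 0" for z
    proof (rule ccontr)
      assume "\<not> (\<forall>j<n. z j = 0)"
      then obtain j where j: "j < n" "z j \<noteq> 0" by auto
      \<comment> \<open>Vandermonde argument: a nonzero polynomial of degree at most
        \<open>n - 1\<close> cannot vanish at the \<open>n\<close> distinct points
        \<open>x i\<close>.\<close>
      define R where "R = {t. (\<Sum>j\<le>n - 1. z j * t ^ j) = 0}"
      have "finite R \<and> card R \<le> n - 1"
        unfolding R_def using j by (intro polyfun_rootbound[of z j]) auto
      moreover have "x ` {..<n} \<subseteq> R"
      proof -
        have "{..n - 1} = {..<n}" using n by auto
        then show ?thesis using z by (auto simp: R_def)
      qed
      ultimately have "card (x ` {..<n}) \<le> n - 1"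
        by (meson card_mono order_trans)
      then show False using n card_image[OF inj] by simp
    qed
    show "in_lattice n ?E (\<lambda>_. 1)" by (fact one)
    show "in_lattice n ?E (\<lambda>i. x i ^ j * x i ^ k)" for j k
      by (rule times_power[OF power])
    show "in_lattice n ?E (\<lambda>i. x i ^ j * x (Suc i mod n) ^ k - x (Suc i mod n) ^ j * x i ^ k)" for j k
      using in_lattice_add[OF times_g_power[OF power, of k j]
          in_lattice_scale[OF times_g_power[OF power, of j k], of "-1"]]
      by (rule in_lattice_cong) (simp add: shift algebra_simps)
    show "in_lattice n ?E (\<lambda>i. x i * x i ^ j)" for j
      by (rule times_x[OF power])
    show "in_lattice n ?E (\<lambda>i. x (Suc i mod n) * x i ^ j)" for j
      using times_g[OF power[of j]] by (rule in_lattice_cong) (simp add: shift)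
    show "\<exists>r. \<forall>i<n. x i ^ k = (\<Sum>a<n. \<Sum>b<n. of_rat (r a b) *
        (x i ^ a * x (Suc i mod n) ^ b - x (Suc i mod n) ^ a * x i ^ b))" if "k < n" for k
      using span[OF that] by (simp add: shift cong: sum.cong)
    show "\<bar>\<Prod>i<n. x i\<bar> = 1" by (fact norm)
    show "\<bar>x i\<bar> \<noteq> 1" if "i < n" for i by (rule abs[OF that])
    show "\<bar>x i ^ k * x (Suc i mod n)\<bar> \<noteq> 1" if "i < n" "1 \<le> k" for i k
      using pow_abs[OF that] step[of i] by (simp add: shift[OF that(1)] abs_mult power_abs)
  qed
qed

text \<open>As \<open>a \<ge> 1\<close>, the product grows with \<open>k\<close>, so it misses 1 if
  it is below 1 at \<open>K\<close> and above 1 at \<open>Suc K\<close>. With \<open>K = 0\<close>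
  it exceeds 1 from the first exponent on.\<close>

lemma power_mult_ne_one_grow:
  fixes a b :: real
  assumes "1 \<le> l" "l \<le> a" "a \<le> h" "0 \<le> l'" "l' \<le> b" "b \<le> h'"
    and "K = 0 \<or> h ^ K * h' < 1" "1 < l ^ Suc K * l'" "1 \<le> k"
  shows "a ^ k * b \<noteq> 1"
proof (cases "k \<le> K")
  case True
  have "a ^ k * b \<le> h ^ K * h'"
    using assms True by (intro mult_mono order_trans[OF power_mono power_increasing]) auto
  then show ?thesis using assms True by auto
next
  case False
  have "l ^ Suc K * l' \<le> a ^ k * b"
    using assms False by (intro mult_mono order_trans[OF power_increasing power_mono]) auto
  then show ?thesis using assms by auto
qed

text \<open>The mirror image for \<open>a \<le> 1\<close>: the product decreases in \<open>k\<close>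
  and crosses 1 strictly between \<open>K\<close> and \<open>Suc K\<close>.\<close>

lemma power_mult_ne_one_shrink:
  fixes a b :: real
  assumes "0 \<le> l" "l \<le> a" "a \<le> h" "h \<le> 1" "0 \<le> l'" "l' \<le> b" "b \<le> h'"
    and "K = 0 \<or> 1 < l ^ K * l'" "h ^ Suc K * h' < 1" "1 \<le> k"
  shows "a ^ k * b \<noteq> 1"
proof (cases "k \<le> K")
  case True
  have "l ^ K * l' \<le> a ^ k * b"
    using assms True by (intro mult_mono order_trans[OF power_decreasing power_mono]) auto
  then show ?thesis using assms True by auto
next
  case False
  have "a ^ k * b \<le> h ^ Suc K * h'"
    using assms False by (intro mult_mono order_trans[OF power_mono power_decreasing]) auto
  then show ?thesis using assms by auto
qed

lemma square_bounds:
  fixes t :: real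
  assumes "0 \<le> l" "l \<le> \<bar>t\<bar>" "\<bar>t\<bar> \<le> h"
  shows "l\<^sup>2 \<le> t\<^sup>2" "t\<^sup>2 \<le> h\<^sup>2"
  using assms power_mono[of l "\<bar>t\<bar>" 2] power_mono[of "\<bar>t\<bar>" h 2] by simp_all

text \<open>The coefficient matrix has row 0 equal to \<open>v\<close> and one more entry
  \<open>w\<close> at position (1, 2). For skew products, where \<open>h i 0 0 = 0\<close>, this
  leaves \<open>n\<close> of them, the least number that can span a space of dimension
  \<open>n\<close>.\<close>

lemma skew_span_witness:
  fixes h :: "nat \<Rightarrow> nat \<Rightarrow> nat \<Rightarrow> real" and v :: "nat \<Rightarrow> rat"
  assumes "3 \<le> n"
    and "\<And>i. i < n \<Longrightarrow> y i = (\<Sum>b<n. of_rat (v b) * h i 0 b) + of_rat w * h i 1 2"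
  shows "\<exists>r. \<forall>i<n. y i = (\<Sum>a<n. \<Sum>b<n. of_rat (r a b) * h i a b)"
proof (intro exI allI impI)
  fix i assume i: "i < n"
  let ?r = "\<lambda>a b. (if a = 0 then v b else 0) + (if b = 2 then if a = 1 then w else 0 else 0)"
  have "(\<Sum>a<n. \<Sum>b<n. of_rat (?r a b) * h i a b)
      = (\<Sum>a<n. \<Sum>b<n. (if a = 0 then of_rat (v b) * h i a b else 0)
          + (if b = 2 then if a = 1 then of_rat w * h i a b else 0 else 0))"
    by (intro sum.cong refl) (simp add: of_rat_add distrib_right)
  also have "\<dots> = (\<Sum>a<n. (if a = 0 then \<Sum>b<n. of_rat (v b) * h i a b else 0)
          + (if a = 1 then of_rat w * h i a 2 else 0))"
  proof (rule sum.cong[OF refl])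
    fix a
    show "(\<Sum>b<n. (if a = 0 then of_rat (v b) * h i a b else 0)
          + (if b = 2 then if a = 1 then of_rat w * h i a b else 0 else 0))
        = (if a = 0 then \<Sum>b<n. of_rat (v b) * h i a b else 0) + (if a = 1 then of_rat w * h i a 2 else 0)"
      using assms(1) by (cases "a = 0"; cases "a = 1") (simp_all cong: if_cong)
  qed
  also have "\<dots> = (\<Sum>b<n. of_rat (v b) * h i 0 b) + of_rat w * h i 1 2"
    using assms(1) by (simp add: sum.distrib)
  finally show "y i = (\<Sum>a<n. \<Sum>b<n. of_rat (?r a b) * h i a b)"
    using assms(2)[OF i] by simp
qed

section \<open>Maximal real subfields of cyclotomic fields in degrees 3, 4 and 5\<close>

text \<open>In the next three proofs the polynomial is the minimal polynomial of \<open>2 cos (2 \<pi> / N)\<close> for \<open>N = 7, 15, 11\<close>;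
  the isolating interval of its largest root is propagated along the orbit. The integer identities
  \<open>cert\<close> solve the linear system that expresses the power basis by the skew products of \<open>(1, u\<^sup>b)\<close> and
  \<open>(u, u\<^sup>2)\<close> modulo this polynomial.\<close>

lemma unit_lattice_3: "\<exists>E s u. unit_lattice 3 E s u"
proof -
  let ?f = "\<lambda>t::real. t ^ 3 + t\<^sup>2 - 2 * t - 1"
  have "\<exists>t\<ge>12460/10000. t \<le> 12480/10000 \<and> ?f t = 0"
    by (rule IVT') (auto intro!: continuous_intros simp: power_divide)
  then obtain t where t: "12460/10000 \<le> t" "t \<le> 12480/10000" "?f t = 0" by blast
  define x where "x i = ((\<lambda>t. t\<^sup>2 - 2) ^^ i) t" for i
  have x0: "x 0 = t" and step: "x (Suc i) = (x i)\<^sup>2 - 2" for i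
    by (simp_all add: x_def)
  have s: "x 1 = (x 0)\<^sup>2 - 2" "x 2 = (x 1)\<^sup>2 - 2" "x 3 = (x 2)\<^sup>2 - 2"
    using step[of 0] step[of 1] step[of 2]
    by (simp_all only: One_nat_def[symmetric] Suc_1 Suc_numeral semiring_norm)
  have x1: "x 1 = t\<^sup>2 - 2" using s(1) x0 by simp
  have x2: "x 2 = 1 - t - t\<^sup>2" using t(3) unfolding s(2) x1 by Groebner_Basis.algebra
  \<comment> \<open>The orbit closes since \<open>2 ^ 3\<close> is 1 modulo 7.\<close>
  have x3: "x 3 = t" using t(3) unfolding s(3) x2 by Groebner_Basis.algebra
  \<comment> \<open>Squaring minus two permutes the roots \<open>r\<close>, so
    \<open>?f (y\<^sup>2 - 2)\<close> is the product of all \<open>y\<^sup>2 - r\<^sup>2\<close>,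
    which splits into \<open>?f y\<close> and, up to sign, \<open>?f (- y)\<close>.\<close>
  have f_step: "?f (y\<^sup>2 - 2) = - ?f y * ?f (- y)" for y by Groebner_Basis.algebra
  have f: "?f (x i) = 0" for i
  proof (induction i)
    case (Suc i)
    then show ?case unfolding step f_step by simp
  qed (simp add: x0 t)
  have b0: "12460/10000 \<le> x 0" "x 0 \<le> 12480/10000" using t x0 by auto
  have b1: "- 4475/10000 \<le> x 1" "x 1 \<le> - 4424/10000"
    using square_bounds[of "12460/10000" "x 0" "12480/10000"] b0 unfolding s(1) by (auto simp: power_divide)
  have b2: "- 18043/10000 \<le> x 2" "x 2 \<le> - 17997/10000"
    using square_bounds[of "4424/10000" "x 1" "4475/10000"] b1 unfolding s(2) by (auto simp: power_divide)
  have less: "i = 0 \<or> i = 1 \<or> i = 2" if "i < 3" for i :: nat using that by auto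
  have sum: "(\<Sum>j<3. F j) = F 0 + F 1 + F 2" for F :: "nat \<Rightarrow> real"
    by (simp add: eval_nat_numeral)
  define h where "h i a b = x i ^ a * ((x i)\<^sup>2 - 2) ^ b - ((x i)\<^sup>2 - 2) ^ a * x i ^ b" for i a b
  have cert: "7 * x i ^ 0 = -5 * h i 0 1 - 1 * h i 0 2 - 3 * h i 1 2"
    "7 * x i ^ 1 = -3 * h i 0 1 - 2 * h i 0 2 + 1 * h i 1 2"
    "7 * x i ^ 2 = -6 * h i 0 1 - 4 * h i 0 2 - 5 * h i 1 2" for i
    using f[of i] unfolding h_def by Groebner_Basis.algebra+
  have "unit_lattice 3 (\<lambda>i j. x i ^ j) (\<lambda>i. Suc i mod 3) x"
  proof (rule unit_lattice_orbit[where q = "\<lambda>j. [1, 2, -1] ! j"])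
    show "inj_on x {..<3}"
      using b0 b1 b2 by (auto simp: inj_on_def dest!: less)
    show "x i ^ 3 = (\<Sum>j<3. of_int ([1, 2, -1] ! j) * x i ^ j)" for i
      using f[of i] by (simp add: sum)
    show "x 3 = x 0" by (simp add: x3 x0)
    show "\<bar>\<Prod>i<3. x i\<bar> = 1"
    proof -
      have "x 0 * x 1 * x 2 = 1"
        using t(3) unfolding x0 x1 x2 by Groebner_Basis.algebra
      then show ?thesis by (simp add: eval_nat_numeral)
    qed
    show "\<bar>x i\<bar> \<noteq> 1" if "i < 3" for i
      using less[OF that] b0 b1 b2 by auto
    show "\<bar>x i\<bar> ^ k * \<bar>x (Suc i)\<bar> \<noteq> 1" if "i < 3" "1 \<le> k" for i k
    proof -
      \<comment> \<open>The product is about 0.86 at \<open>k = 3\<close> and 1.08 at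
        \<open>k = 4\<close>, hence \<open>K = 3\<close>.\<close>
      have "\<bar>x 0\<bar> ^ k * \<bar>x 1\<bar> \<noteq> 1"
        using b0 b1 that(2)
        by (intro power_mult_ne_one_grow[of "12460/10000" _ "12480/10000" "4424/10000" _ "4475/10000" 3])
          (auto simp: power_divide)
      moreover have "\<bar>x 1\<bar> ^ k * \<bar>x 2\<bar> \<noteq> 1"
        using b1 b2 that(2)
        by (intro power_mult_ne_one_shrink[of "4424/10000" _ "4475/10000" "17997/10000" _ "18043/10000" 0])
          (auto simp: power_divide)
      moreover have "\<bar>x 2\<bar> ^ k * \<bar>x 3\<bar> \<noteq> 1"
        using b2 b0 that(2) x3 x0
        by (intro power_mult_ne_one_grow[of "17997/10000" _ "18043/10000" "12460/10000" _ "12480/10000" 0])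
          (auto simp: power_divide)
      ultimately show ?thesis
        using less[OF that(1)]
        by (elim disjE) (simp_all only: One_nat_def[symmetric] Suc_1 Suc_numeral semiring_norm not_False_eq_True)
    qed
    show "\<exists>r. \<forall>i<3. x i ^ k = (\<Sum>a<3. \<Sum>b<3. of_rat (r a b) *
        (x i ^ a * ((x i)\<^sup>2 - 2) ^ b - ((x i)\<^sup>2 - 2) ^ a * x i ^ b))" if "k < 3" for k
      unfolding h_def[symmetric]
    proof (rule skew_span_witness[where
          v = "\<lambda>b. [[0, -5/7, -1/7], [0, -3/7, -2/7], [0, -6/7, -4/7]] ! k ! b" and
          w = "[-3/7, 1/7, -5/7] ! k"])
      fix i
      have "h i 0 0 = 0" by (simp add: h_def)
      then show "x i ^ k = (\<Sum>b<3. of_rat ([[0, -5/7, -1/7], [0, -3/7, -2/7], [0, -6/7, -4/7]] ! k ! b) * h i 0 b) +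
          of_rat ([-3/7, 1/7, -5/7] ! k) * h i 1 2"
        using less[OF that] cert[of i] unfolding sum
        by (elim disjE) (simp_all add: of_rat_divide of_rat_minus)
    qed simp
  qed (simp_all add: step)
  then show ?thesis by blast
qed

lemma unit_lattice_4: "\<exists>E s u. unit_lattice 4 E s u"
proof -
  let ?f = "\<lambda>t::real. t ^ 4 - t ^ 3 - 4 * t\<^sup>2 + 4 * t + 1"
  have "\<exists>t\<ge>18270/10000. t \<le> 18272/10000 \<and> ?f t = 0"
    by (rule IVT') (auto intro!: continuous_intros simp: power_divide)
  then obtain t where t: "18270/10000 \<le> t" "t \<le> 18272/10000" "?f t = 0" by blast
  define x where "x i = ((\<lambda>t. t\<^sup>2 - 2) ^^ i) t" for i
  have x0: "x 0 = t" and step: "x (Suc i) = (x i)\<^sup>2 - 2" for i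
    by (simp_all add: x_def)
  have s: "x 1 = (x 0)\<^sup>2 - 2" "x 2 = (x 1)\<^sup>2 - 2" "x 3 = (x 2)\<^sup>2 - 2" "x 4 = (x 3)\<^sup>2 - 2"
    using step[of 0] step[of 1] step[of 2] step[of 3]
    by (simp_all only: One_nat_def[symmetric] Suc_1 Suc_numeral semiring_norm)
  have x1: "x 1 = t\<^sup>2 - 2" using s(1) x0 by simp
  have x2: "x 2 = 1 - 4 * t + t ^ 3" using t(3) unfolding s(2) x1 by Groebner_Basis.algebra
  have x3: "x 3 = 2 + 3 * t - t\<^sup>2 - t ^ 3" using t(3) unfolding s(3) x2 by Groebner_Basis.algebra
  \<comment> \<open>Here \<open>2 ^ 4\<close> is 1 modulo 15, while no smaller positive power of 2
    is 1 or -1.\<close>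
  have x4: "x 4 = t" using t(3) unfolding s(4) x3 by Groebner_Basis.algebra
  have f_step: "?f (y\<^sup>2 - 2) = ?f y * ?f (- y)" for y by Groebner_Basis.algebra
  have f: "?f (x i) = 0" for i
  proof (induction i)
    case (Suc i)
    then show ?case unfolding step f_step by simp
  qed (simp add: x0 t)
  have b0: "18270/10000 \<le> x 0" "x 0 \<le> 18272/10000" using t x0 by auto
  have b1: "13379/10000 \<le> x 1" "x 1 \<le> 13387/10000"
    using square_bounds[of "18270/10000" "x 0" "18272/10000"] b0 unfolding s(1) by (auto simp: power_divide)
  have b2: "- 2101/10000 \<le> x 2" "x 2 \<le> - 2078/10000"
    using square_bounds[of "13379/10000" "x 1" "13387/10000"] b1 unfolding s(2) by (auto simp: power_divide)
  have b3: "- 19569/10000 \<le> x 3" "x 3 \<le> - 19558/10000"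
    using square_bounds[of "2078/10000" "x 2" "2101/10000"] b2 unfolding s(3) by (auto simp: power_divide)
  have less: "i = 0 \<or> i = 1 \<or> i = 2 \<or> i = 3" if "i < 4" for i :: nat using that by auto
  have sum: "(\<Sum>j<4. F j) = F 0 + F 1 + F 2 + F 3" for F :: "nat \<Rightarrow> real"
    by (simp add: eval_nat_numeral)
  define h where "h i a b = x i ^ a * ((x i)\<^sup>2 - 2) ^ b - ((x i)\<^sup>2 - 2) ^ a * x i ^ b" for i a b
  have cert: "15 * x i ^ 0 = -7 * h i 0 1 - 2 * h i 0 2 - 1 * h i 0 3 - 4 * h i 1 2"
    "15 * x i ^ 1 = 2 * h i 0 1 - 8 * h i 0 2 - 4 * h i 0 3 - 1 * h i 1 2"
    "15 * x i ^ 2 = 3 * h i 0 1 - 12 * h i 0 2 - 6 * h i 0 3 - 9 * h i 1 2"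
    "15 * x i ^ 3 = 32 * h i 0 1 - 23 * h i 0 2 - 19 * h i 0 3 - 1 * h i 1 2" for i
    using f[of i] unfolding h_def by Groebner_Basis.algebra+
  have "unit_lattice 4 (\<lambda>i j. x i ^ j) (\<lambda>i. Suc i mod 4) x"
  proof (rule unit_lattice_orbit[where q = "\<lambda>j. [-1, -4, 4, 1] ! j"])
    show "inj_on x {..<4}"
      using b0 b1 b2 b3 by (auto simp: inj_on_def dest!: less)
    show "x i ^ 4 = (\<Sum>j<4. of_int ([-1, -4, 4, 1] ! j) * x i ^ j)" for i
      using f[of i] by (simp add: sum)
    show "x 4 = x 0" by (simp add: x4 x0)
    show "\<bar>\<Prod>i<4. x i\<bar> = 1"
    proof -
      have "x 0 * x 1 * x 2 * x 3 = 1"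
        using t(3) unfolding x0 x1 x2 x3 by Groebner_Basis.algebra
      then show ?thesis by (simp add: eval_nat_numeral)
    qed
    show "\<bar>x i\<bar> \<noteq> 1" if "i < 4" for i
      using less[OF that] b0 b1 b2 b3 by auto
    show "\<bar>x i\<bar> ^ k * \<bar>x (Suc i)\<bar> \<noteq> 1" if "i < 4" "1 \<le> k" for i k
    proof -
      have "\<bar>x 0\<bar> ^ k * \<bar>x 1\<bar> \<noteq> 1"
        using b0 b1 that(2)
        by (intro power_mult_ne_one_grow[of "18270/10000" _ "18272/10000" "13379/10000" _ "13387/10000" 0])
          (auto simp: power_divide)
      \<comment> \<open>The product is about 0.90 at \<open>k = 5\<close> and 1.20 at
        \<open>k = 6\<close>, hence \<open>K = 5\<close>.\<close>
      moreover have "\<bar>x 1\<bar> ^ k * \<bar>x 2\<bar> \<noteq> 1"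
        using b1 b2 that(2)
        by (intro power_mult_ne_one_grow[of "13379/10000" _ "13387/10000" "2078/10000" _ "2101/10000" 5])
          (auto simp: power_divide)
      moreover have "\<bar>x 2\<bar> ^ k * \<bar>x 3\<bar> \<noteq> 1"
        using b2 b3 that(2)
        by (intro power_mult_ne_one_shrink[of "2078/10000" _ "2101/10000" "19558/10000" _ "19569/10000" 0])
          (auto simp: power_divide)
      moreover have "\<bar>x 3\<bar> ^ k * \<bar>x 4\<bar> \<noteq> 1"
        using b3 b0 that(2) x4 x0
        by (intro power_mult_ne_one_grow[of "19558/10000" _ "19569/10000" "18270/10000" _ "18272/10000" 0])
          (auto simp: power_divide)
      ultimately show ?thesis
        using less[OF that(1)]
        by (elim disjE) (simp_all only: One_nat_def[symmetric] Suc_1 Suc_numeral semiring_norm not_False_eq_True)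
    qed
    show "\<exists>r. \<forall>i<4. x i ^ k = (\<Sum>a<4. \<Sum>b<4. of_rat (r a b) *
        (x i ^ a * ((x i)\<^sup>2 - 2) ^ b - ((x i)\<^sup>2 - 2) ^ a * x i ^ b))" if "k < 4" for k
      unfolding h_def[symmetric]
    proof (rule skew_span_witness[where
          v = "\<lambda>b. [[0, -7/15, -2/15, -1/15], [0, 2/15, -8/15, -4/15], [0, 3/15, -12/15, -6/15], [0, 32/15, -23/15, -19/15]] ! k ! b" and
          w = "[-4/15, -1/15, -9/15, -1/15] ! k"])
      fix i
      have "h i 0 0 = 0" by (simp add: h_def)
      then show "x i ^ k = (\<Sum>b<4. of_rat ([[0, -7/15, -2/15, -1/15], [0, 2/15, -8/15, -4/15], [0, 3/15, -12/15, -6/15], [0, 32/15, -23/15, -19/15]] ! k ! b) * h i 0 b) +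
          of_rat ([-4/15, -1/15, -9/15, -1/15] ! k) * h i 1 2"
        using less[OF that] cert[of i] unfolding sum
        by (elim disjE) (simp_all add: of_rat_divide of_rat_minus)
    qed simp
  qed (simp_all add: step)
  then show ?thesis by blast
qed

lemma unit_lattice_5: "\<exists>E s u. unit_lattice 5 E s u"
proof -
  let ?f = "\<lambda>t::real. t ^ 5 + t ^ 4 - 4 * t ^ 3 - 3 * t\<^sup>2 + 3 * t + 1"
  \<comment> \<open>Each step stretches an interval by less than 4, as the derivative is
    \<open>2 * t\<close> and the orbit stays within (-2, 2); a width of 1/10000 is fine enough for
    four steps.\<close>
  have "\<exists>t\<ge>16825/10000. t \<le> 16826/10000 \<and> ?f t = 0"
    by (rule IVT') (auto intro!: continuous_intros simp: power_divide)
  then obtain t where t: "16825/10000 \<le> t" "t \<le> 16826/10000" "?f t = 0" by blast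
  define x where "x i = ((\<lambda>t. t\<^sup>2 - 2) ^^ i) t" for i
  have x0: "x 0 = t" and step: "x (Suc i) = (x i)\<^sup>2 - 2" for i
    by (simp_all add: x_def)
  have s: "x 1 = (x 0)\<^sup>2 - 2" "x 2 = (x 1)\<^sup>2 - 2" "x 3 = (x 2)\<^sup>2 - 2" "x 4 = (x 3)\<^sup>2 - 2" "x 5 = (x 4)\<^sup>2 - 2"
    using step[of 0] step[of 1] step[of 2] step[of 3] step[of 4]
    by (simp_all only: One_nat_def[symmetric] Suc_1 Suc_numeral semiring_norm)
  have x1: "x 1 = t\<^sup>2 - 2" using s(1) x0 by simp
  have x2: "x 2 = 2 - 4 * t\<^sup>2 + t ^ 4" unfolding s(2) x1 by Groebner_Basis.algebra
  have x3: "x 3 = t ^ 3 - 3 * t" using t(3) unfolding s(3) x2 by Groebner_Basis.algebra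
  have x4: "x 4 = 2 * t + 3 * t\<^sup>2 - t ^ 3 - t ^ 4 - 1" using t(3) unfolding s(4) x3 by Groebner_Basis.algebra
  \<comment> \<open>Here \<open>2 ^ 5\<close> is -1 modulo 11: the angle is negated and the cosine
    returns.\<close>
  have x5: "x 5 = t" using t(3) unfolding s(5) x4 by Groebner_Basis.algebra
  have f_step: "?f (y\<^sup>2 - 2) = - ?f y * ?f (- y)" for y by Groebner_Basis.algebra
  have f: "?f (x i) = 0" for i
  proof (induction i)
    case (Suc i)
    then show ?case unfolding step f_step by simp
  qed (simp add: x0 t)
  have b0: "16825/10000 \<le> x 0" "x 0 \<le> 16826/10000" using t x0 by auto
  have b1: "8308/10000 \<le> x 1" "x 1 \<le> 8312/10000"
    using square_bounds[of "16825/10000" "x 0" "16826/10000"] b0 unfolding s(1) by (auto simp: power_divide)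
  have b2: "- 13098/10000 \<le> x 2" "x 2 \<le> - 13091/10000"
    using square_bounds[of "8308/10000" "x 1" "8312/10000"] b1 unfolding s(2) by (auto simp: power_divide)
  have b3: "- 2863/10000 \<le> x 3" "x 3 \<le> - 2844/10000"
    using square_bounds[of "13091/10000" "x 2" "13098/10000"] b2 unfolding s(3) by (auto simp: power_divide)
  have b4: "- 19192/10000 \<le> x 4" "x 4 \<le> - 19180/10000"
    using square_bounds[of "2844/10000" "x 3" "2863/10000"] b3 unfolding s(4) by (auto simp: power_divide)
  have less: "i = 0 \<or> i = 1 \<or> i = 2 \<or> i = 3 \<or> i = 4" if "i < 5" for i :: nat using that by auto
  have sum: "(\<Sum>j<5. F j) = F 0 + F 1 + F 2 + F 3 + F 4" for F :: "nat \<Rightarrow> real"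
    by (simp add: eval_nat_numeral)
  define h where "h i a b = x i ^ a * ((x i)\<^sup>2 - 2) ^ b - ((x i)\<^sup>2 - 2) ^ a * x i ^ b" for i a b
  have cert: "11 * x i ^ 0 = -21 * h i 0 1 - 30 * h i 0 2 + 4 * h i 0 3 + 8 * h i 0 4 - 5 * h i 1 2"
    "11 * x i ^ 1 = 2 * h i 0 1 + 17 * h i 0 2 - 3 * h i 0 3 - 6 * h i 0 4 + 1 * h i 1 2"
    "11 * x i ^ 2 = -29 * h i 0 1 - 43 * h i 0 2 + 5 * h i 0 3 + 10 * h i 0 4 - 9 * h i 1 2"
    "11 * x i ^ 3 = 19 * h i 0 1 + 35 * h i 0 2 - 12 * h i 0 3 - 13 * h i 0 4 + 4 * h i 1 2"
    "11 * x i ^ 4 = -61 * h i 0 1 - 84 * h i 0 2 + 9 * h i 0 3 + 18 * h i 0 4 - 25 * h i 1 2" for i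
    using f[of i] unfolding h_def by Groebner_Basis.algebra+
  have "unit_lattice 5 (\<lambda>i j. x i ^ j) (\<lambda>i. Suc i mod 5) x"
  proof (rule unit_lattice_orbit[where q = "\<lambda>j. [-1, -3, 3, 4, -1] ! j"])
    show "inj_on x {..<5}"
      using b0 b1 b2 b3 b4 by (auto simp: inj_on_def dest!: less)
    show "x i ^ 5 = (\<Sum>j<5. of_int ([-1, -3, 3, 4, -1] ! j) * x i ^ j)" for i
      using f[of i] by (simp add: sum)
    show "x 5 = x 0" by (simp add: x5 x0)
    show "\<bar>\<Prod>i<5. x i\<bar> = 1"
    proof -
      have "x 0 * x 1 * x 2 * x 3 * x 4 = - 1"
        using t(3) unfolding x0 x1 x2 x3 x4 by Groebner_Basis.algebra
      then show ?thesis by (simp add: eval_nat_numeral)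
    qed
    show "\<bar>x i\<bar> \<noteq> 1" if "i < 5" for i
      using less[OF that] b0 b1 b2 b3 b4 by auto
    show "\<bar>x i\<bar> ^ k * \<bar>x (Suc i)\<bar> \<noteq> 1" if "i < 5" "1 \<le> k" for i k
    proof -
      have "\<bar>x 0\<bar> ^ k * \<bar>x 1\<bar> \<noteq> 1"
        using b0 b1 that(2)
        by (intro power_mult_ne_one_grow[of "16825/10000" _ "16826/10000" "8308/10000" _ "8312/10000" 0])
          (auto simp: power_divide)
      moreover have "\<bar>x 1\<bar> ^ k * \<bar>x 2\<bar> \<noteq> 1"
        using b1 b2 that(2)
        by (intro power_mult_ne_one_shrink[of "8308/10000" _ "8312/10000" "13091/10000" _ "13098/10000" 1])
          (auto simp: power_divide)
      moreover have "\<bar>x 2\<bar> ^ k * \<bar>x 3\<bar> \<noteq> 1"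
        using b2 b3 that(2)
        by (intro power_mult_ne_one_grow[of "13091/10000" _ "13098/10000" "2844/10000" _ "2863/10000" 4])
          (auto simp: power_divide)
      moreover have "\<bar>x 3\<bar> ^ k * \<bar>x 4\<bar> \<noteq> 1"
        using b3 b4 that(2)
        by (intro power_mult_ne_one_shrink[of "2844/10000" _ "2863/10000" "19180/10000" _ "19192/10000" 0])
          (auto simp: power_divide)
      moreover have "\<bar>x 4\<bar> ^ k * \<bar>x 5\<bar> \<noteq> 1"
        using b4 b0 that(2) x5 x0
        by (intro power_mult_ne_one_grow[of "19180/10000" _ "19192/10000" "16825/10000" _ "16826/10000" 0])
          (auto simp: power_divide)
      ultimately show ?thesis
        using less[OF that(1)]
        by (elim disjE) (simp_all only: One_nat_def[symmetric] Suc_1 Suc_numeral semiring_norm not_False_eq_True)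
    qed
    show "\<exists>r. \<forall>i<5. x i ^ k = (\<Sum>a<5. \<Sum>b<5. of_rat (r a b) *
        (x i ^ a * ((x i)\<^sup>2 - 2) ^ b - ((x i)\<^sup>2 - 2) ^ a * x i ^ b))" if "k < 5" for k
      unfolding h_def[symmetric]
    proof (rule skew_span_witness[where
          v = "\<lambda>b. [[0, -21/11, -30/11, 4/11, 8/11], [0, 2/11, 17/11, -3/11, -6/11], [0, -29/11, -43/11, 5/11, 10/11], [0, 19/11, 35/11, -12/11, -13/11], [0, -61/11, -84/11, 9/11, 18/11]] ! k ! b" and
          w = "[-5/11, 1/11, -9/11, 4/11, -25/11] ! k"])
      fix i
      have "h i 0 0 = 0" by (simp add: h_def)
      then show "x i ^ k = (\<Sum>b<5. of_rat ([[0, -21/11, -30/11, 4/11, 8/11], [0, 2/11, 17/11, -3/11, -6/11], [0, -29/11, -43/11, 5/11, 10/11], [0, 19/11, 35/11, -12/11, -13/11], [0, -61/11, -84/11, 9/11, 18/11]] ! k ! b) * h i 0 b) +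
          of_rat ([-5/11, 1/11, -9/11, 4/11, -25/11] ! k) * h i 1 2"
        using less[OF that] cert[of i] unfolding sum
        by (elim disjE) (simp_all add: of_rat_divide of_rat_minus)
    qed simp
  qed (simp_all add: step)
  then show ?thesis by blast
qed

section \<open>Existence in every degree from 3 on\<close>

lemma unit_lattice_exists:
  assumes "3 \<le> n"
  shows "\<exists>E s u. unit_lattice n E s u"
  using assms
proof (induction n rule: less_induct)
  case (less n)
  show ?case
  proof (cases "n < 6")
    case True
    then have "n = 3 \<or> n = 4 \<or> n = 5" using less.prems by auto
    then show ?thesis using unit_lattice_3 unit_lattice_4 unit_lattice_5 by auto
  next
    case False
    \<comment> \<open>A summand of degree 3 is split off; \<open>n \<ge> 6\<close> leaves a degree
      of at least 3.\<close>
    then have "\<exists>E s u. unit_lattice (n - 3) E s u" by (intro less.IH) auto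
    then obtain E s u where "unit_lattice (n - 3) E s u" by blast
    moreover obtain E' s' u' where "unit_lattice 3 E' s' u'" using unit_lattice_3 by auto
    ultimately have "\<exists>E s u. unit_lattice (n - 3 + 3) E s u" using unit_lattice_add by blast
    then show ?thesis using False by simp
  qed
qed

theorem theorem3p7:
  fixes c n :: nat
  assumes "c \<ge> 1" and "n > 2"
  shows "\<exists>d C. is_lie_algebra d C \<and> nilpotency_class d C c \<and>
           has_type d C c (replicate c n) \<and> anosov d C"
proof -
  obtain E s u where "unit_lattice n E s u" using unit_lattice_exists[of n] assms by auto
  then interpret unit_lattice n E s u .
  show ?thesis
    using lie_algebra nilpotency_class[of c] has_type anosov_lie_algebra assms
    by (intro exI[of _ "c * n"] exI[of _ lie_const]) auto
qed

end
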